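(* Let $p$ be an odd prime. Let $H$ be a finite special Miller $p$-group satisfying: $H^p<H'$ (proper containment); the map $H/H'\rightarrow H^p$, $hH'\mapsto h^p$, is injective; and $H'$ is freely generated by the commutators $[x_i,x_j]$, $1\leq i<j\leq n$, whenever $\{x_1,\ldots,x_n\}$ is a minimal generating set for $H$. Let $M$ be a subgroup of order $p$ in $H'$ with $M\nsubseteq H^p$. Let $G_2=H\rtimes_M\langle w\rangle$, where $\langle w\rangle$ is a cyclic $p$-group, the order of $w$ is greater than $p^2$, and $w$ acts on $H$ via a non-inner central automorphism of $H$. If $H/M$ is a special Miller $p$-group, then $G_2$ is a (non-special) Miller group.
   Context: Notation: $[x,y]=xyx^{-1}y^{-1}$; $H'$ is the commutator subgroup of $H$; $H^p=\langle h^p : h\in H\rangle$; $\Phi(H)$ is the Frattini subgroup and $Z(H)$ the center. A Miller group is a non-abelian group whose automorphism group is abelian. A $p$-group $K$ is special if $Z(K)=K'=\Phi(K)$. (For $H$ special and $p$ odd, the map $hH'\mapsto h^p$ is well defined.) An automorphism of a group $K$ is central if it induces the identity on $K/Z(K)$. "$H'$ is freely generated by the $[x_i,x_j]$, $1\le i<j\le n$" means that these commutators form a basis of the elementary abelian $p$-group $H'$ regarded as a vector space over $\mathbb{F}_p$; thus $|H|=p^{n+\binom{n}{2}}$. Amalgamated semi-direct product: a group $G$ is the amalgamated semi-direct product of subgroups $H$ by $K$ over $M$, written $G=H\rtimes_M K$, if $H\trianglelefteq G$, $G=HK$ and $H\cap K=M$. (Externally: $M\leq H$ is identified with a subgroup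 of $K$ by an injective homomorphism, compatibly with a given action of $K$ on $H$.) Here $K=\langle w\rangle$, and conjugation by $w$ inside $G_2$ restricts to the given non-inner central automorphism of $H$, and $H\cap\langle w\rangle=M$. *)

theory Defs
  imports
    "HOL-Algebra.Bij"
    "HOL-Algebra.Generated_Groups"
    "HOL-Algebra.Multiplicative_Group"
    "HOL-Computational_Algebra.Primes"
begin

text \<open>
  The commutator subgroup of \<open>K\<close> is \<open>derived K (carrier K)\<close>, and the automorphism group is
  \<open>AutoGroup K\<close>. A subgroup \<open>H\<close> of \<open>G\<close>, viewed as a group, is \<open>G\<lparr>carrier := H\<rparr>\<close>.
\<close>

definition group_commutator :: "('a, 'b) monoid_scheme \<Rightarrow> 'a \<Rightarrow> 'a \<Rightarrow> 'a" where
  "group_commutator K x y = x \<otimes>\<^bsub>K\<^esub> y \<otimes>\<^bsub>K\<^esub> inv\<^bsub>K\<^esub> x \<otimes>\<^bsub>K\<^esub> inv\<^bsub>K\<^esub> y"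

definition group_center :: "('a, 'b) monoid_scheme \<Rightarrow> 'a set" where
  "group_center K = {z \<in> carrier K. \<forall>x\<in>carrier K. z \<otimes>\<^bsub>K\<^esub> x = x \<otimes>\<^bsub>K\<^esub> z}"

definition maximal_subgroup :: "'a set \<Rightarrow> ('a, 'b) monoid_scheme \<Rightarrow> bool" where
  "maximal_subgroup M K \<longleftrightarrow>
     subgroup M K \<and> M \<noteq> carrier K \<and>
     (\<forall>N. subgroup N K \<and> M \<subseteq> N \<longrightarrow> N = M \<or> N = carrier K)"

text \<open>Intersecting with the carrier makes the Frattini subgroup the whole group when there are no
  maximal subgroups.\<close>
definition frattini :: "('a, 'b) monoid_scheme \<Rightarrow> 'a set" where
  "frattini K = carrier K \<inter> \<Inter> {M. maximal_subgroup M K}"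

definition power_subgroup :: "('a, 'b) monoid_scheme \<Rightarrow> nat \<Rightarrow> 'a set" where
  "power_subgroup K p = generate K ((\<lambda>h. h [^]\<^bsub>K\<^esub> p) ` carrier K)"

text \<open>The map \<open>hK' \<mapsto> h\<^sup>p\<close> on cosets of the commutator subgroup \<open>K'\<close>. It is meaningful when all
  elements of a coset have the same \<open>p\<close>-th power, as is the case for \<open>K\<close> a special \<open>p\<close>-group
  with \<open>p\<close> odd.\<close>
definition coset_power :: "('a, 'b) monoid_scheme \<Rightarrow> nat \<Rightarrow> 'a set \<Rightarrow> 'a" where
  "coset_power K p X = the_elem ((\<lambda>h. h [^]\<^bsub>K\<^esub> p) ` X)"

definition p_group :: "nat \<Rightarrow> ('a, 'b) monoid_scheme \<Rightarrow> bool" where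
  "p_group p K \<longleftrightarrow> group K \<and> (\<forall>x\<in>carrier K. \<exists>k. group.ord K x = p ^ k)"

text \<open>That \<open>K\<close> is a \<open>p\<close>-group is not part of this predicate; it is required separately.\<close>
definition special_group :: "('a, 'b) monoid_scheme \<Rightarrow> bool" where
  "special_group K \<longleftrightarrow>
     group K \<and> group_center K = derived K (carrier K) \<and> derived K (carrier K) = frattini K"

definition miller_group :: "('a, 'b) monoid_scheme \<Rightarrow> bool" where
  "miller_group K \<longleftrightarrow> group K \<and> \<not> comm_group K \<and> comm_group (AutoGroup K)"

definition central_automorphism :: "('a, 'b) monoid_scheme \<Rightarrow> ('a \<Rightarrow> 'a) \<Rightarrow> bool" where
  "central_automorphism K f \<longleftrightarrow>
     f \<in> auto K \<and>
     (\<forall>x\<in>carrier K. group_center K #>\<^bsub>K\<^esub> f x = group_center K #>\<^bsub>K\<^esub> x)"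

text \<open>Elements of \<open>auto K\<close> are extensional, hence the restriction to a set.\<close>
definition conjugation :: "('a, 'b) monoid_scheme \<Rightarrow> 'a \<Rightarrow> 'a set \<Rightarrow> 'a \<Rightarrow> 'a" where
  "conjugation G g H = (\<lambda>h\<in>H. g \<otimes>\<^bsub>G\<^esub> h \<otimes>\<^bsub>G\<^esub> inv\<^bsub>G\<^esub> g)"

definition inner_automorphism :: "('a, 'b) monoid_scheme \<Rightarrow> ('a \<Rightarrow> 'a) \<Rightarrow> bool" where
  "inner_automorphism K f \<longleftrightarrow> (\<exists>g\<in>carrier K. f = conjugation K g (carrier K))"

definition minimal_generating_set :: "('a, 'b) monoid_scheme \<Rightarrow> 'a set \<Rightarrow> bool" where
  "minimal_generating_set K X \<longleftrightarrow>
     X \<subseteq> carrier K \<and> generate K X = carrier K \<and> (\<forall>Y. Y \<subset> X \<longrightarrow> generate K Y \<noteq> carrier K)"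

text \<open>For a (multiplicatively written) elementary abelian \<open>p\<close>-group \<open>A\<close> and a finite index set \<open>I\<close>:
  the family \<open>c\<close> spans \<open>A\<close> and is linearly independent over \<open>\<int>/p\<int>\<close>. A scalar is represented by
  an integer \<open>e\<close>, acting as \<open>a \<mapsto> a\<^sup>e\<close>; it is zero iff \<open>p\<close> divides \<open>e\<close>.\<close>
definition elementary_abelian_basis ::
    "nat \<Rightarrow> ('a, 'b) monoid_scheme \<Rightarrow> 'i set \<Rightarrow> ('i \<Rightarrow> 'a) \<Rightarrow> bool" where
  "elementary_abelian_basis p A I c \<longleftrightarrow>
     c \<in> I \<rightarrow> carrier A \<and>
     (\<forall>a\<in>carrier A. \<exists>e :: 'i \<Rightarrow> int. a = (\<Otimes>\<^bsub>A\<^esub>i\<in>I. c i [^]\<^bsub>A\<^esub> e i)) \<and>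
     (\<forall>e :: 'i \<Rightarrow> int. (\<Otimes>\<^bsub>A\<^esub>i\<in>I. c i [^]\<^bsub>A\<^esub> e i) = \<one>\<^bsub>A\<^esub> \<longrightarrow> (\<forall>i\<in>I. int p dvd e i))"

text \<open>The generators \<open>x\<^sub>1, \<dots>, x\<^sub>n\<close> are pairwise distinct.\<close>
definition commutators_freely_generate :: "nat \<Rightarrow> ('a, 'b) monoid_scheme \<Rightarrow> bool" where
  "commutators_freely_generate p K \<longleftrightarrow>
     (\<forall>(n::nat) (x :: nat \<Rightarrow> 'a).
        inj_on x {1..n} \<and> minimal_generating_set K (x ` {1..n}) \<longrightarrow>
        elementary_abelian_basis p (K\<lparr>carrier := derived K (carrier K)\<rparr>)
          {(i, j). 1 \<le> i \<and> i < j \<and> j \<le> n}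
          (\<lambda>(i, j). group_commutator K (x i) (x j)))"

definition amalgamated_semidirect_product ::
    "('a, 'b) monoid_scheme \<Rightarrow> 'a set \<Rightarrow> 'a set \<Rightarrow> 'a set \<Rightarrow> bool" where
  "amalgamated_semidirect_product G H K M \<longleftrightarrow>
     group G \<and> H \<lhd> G \<and> subgroup K G \<and> carrier G = H <#>\<^bsub>G\<^esub> K \<and> H \<inter> K = M"

end

theory Submission
  imports Defs
begin

text \<open>
  Write \<open>D = H'\<close> and \<open>v = w\<^sup>p\<close>. Since \<open>w\<close> acts centrally and \<open>D\<close> has exponent \<open>p\<close>, the element
  \<open>v\<close> is central, \<open>G\<close> has class 2, and the \<open>p\<close>-th power map is multiplicative on \<open>G\<close> with kernel \<open>D\<close>.
  Hence an automorphism \<open>\<alpha>\<close> of \<open>G\<close> maps \<open>D\<close> and \<open>M\<close> into themselves and \<open>H\<close> into \<open>H\<langle>v\<rangle>\<close>.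
  Reading \<open>\<alpha>\<close> on \<open>H\<close> modulo \<open>\<langle>v\<rangle>\<close> yields an automorphism of \<open>H/M\<close>, which is central because
  \<open>H/M\<close> is Miller; as \<open>H/M\<close> is special, \<open>\<alpha>\<close> is central on \<open>H\<close>, and so trivial on \<open>D\<close>.
  Comparing \<open>[\<alpha>(w), \<alpha>(x)] = \<alpha>([w, x]) = [w, x]\<close> for \<open>x \<in> H\<close>, and using that \<open>w\<close> does not act by
  an inner automorphism, gives \<open>\<alpha>(w) \<in> D\<langle>v\<rangle>w\<close>. All automorphisms are therefore central, and their
  explicit form on \<open>H\<close> and \<open>w\<close> shows that they commute. Finally \<open>v \<in> Z(G)\<close> but \<open>v \<notin> H\<close>, while
  \<open>G' \<subseteq> H\<close>, so \<open>Z(G) \<noteq> G'\<close>.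
\<close>

section \<open>Powers in groups of class two\<close>

lemma (in group) mult_inv_cancel:
  assumes "x \<in> carrier G" "y \<in> carrier G"
  shows "inv x \<otimes> (x \<otimes> y) = y" "x \<otimes> (inv x \<otimes> y) = y"
  using assms by (simp_all flip: m_assoc)

text \<open>Each of the \<open>n\<close> factors \<open>y\<close> leaves one \<open>c\<close> behind
  when it passes \<open>x\<close>, and these collect on the left because \<open>c\<close> commutes
  with \<open>y\<close>. This is \<open>[y^n, x] = [y, x]^n\<close> with \<open>c\<close> in the
  role of \<open>[y, x]\<close>.\<close>

lemma (in group) pow_mult_twisted_commute:
  fixes n :: nat
  assumes [simp]: "x \<in> carrier G" "y \<in> carrier G" "c \<in> carrier G"
    and yx: "y \<otimes> x = c \<otimes> (x \<otimes> y)" and cy: "c \<otimes> y = y \<otimes> c"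
  shows "y [^] n \<otimes> x = c [^] n \<otimes> (x \<otimes> y [^] n)"
proof (induction n)
  case (Suc n)
  have "y [^] n \<otimes> c = c \<otimes> y [^] n"
    using group_commutes_pow[of y c n] cy by simp
  have "y [^] Suc n \<otimes> x = y [^] n \<otimes> (c \<otimes> (x \<otimes> y))"
    by (simp add: m_assoc yx)
  also have "\<dots> = (y [^] n \<otimes> c) \<otimes> (x \<otimes> y)"
    by (simp add: m_assoc)
  also have "\<dots> = c \<otimes> (y [^] n \<otimes> x) \<otimes> y"
    by (simp add: m_assoc \<open>y [^] n \<otimes> c = c \<otimes> y [^] n\<close>)
  also have "\<dots> = (c \<otimes> c [^] n) \<otimes> (x \<otimes> (y [^] n \<otimes> y))"
    by (simp add: Suc m_assoc)
  also have "\<dots> = c [^] Suc n \<otimes> (x \<otimes> y [^] Suc n)"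
    unfolding nat_pow_Suc2[OF assms(3)] by simp
  finally show ?case .
qed simp

text \<open>Class-two collection formula: the exponent of \<open>c\<close> is the binomial
  coefficient n over 2, counting the pairs in which a factor \<open>y\<close> has to pass a later
  factor \<open>x\<close>.\<close>

lemma (in group) mult_pow_twisted_commute:
  fixes n :: nat
  assumes [simp]: "x \<in> carrier G" "y \<in> carrier G" "c \<in> carrier G"
    and yx: "y \<otimes> x = c \<otimes> (x \<otimes> y)" and cx: "c \<otimes> x = x \<otimes> c" and cy: "c \<otimes> y = y \<otimes> c"
  shows "(x \<otimes> y) [^] n = c [^] (n * (n - 1) div 2) \<otimes> (x [^] n \<otimes> y [^] n)"
proof (induction n)
  case (Suc n)
  let ?t = "n * (n - 1) div 2"
  have t: "?t + n = Suc n * (Suc n - 1) div 2"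
    by (cases n) (auto simp: algebra_simps)
  have xc: "x [^] n \<otimes> c [^] n = c [^] n \<otimes> x [^] n"
    using cx by (metis assms(1,3) group_commutes_pow nat_pow_closed)
  have "(x \<otimes> y) [^] Suc n = c [^] ?t \<otimes> (x [^] n \<otimes> ((y [^] n \<otimes> x) \<otimes> y))"
    by (simp add: Suc m_assoc)
  also have "\<dots> = c [^] ?t \<otimes> ((x [^] n \<otimes> c [^] n) \<otimes> (x \<otimes> (y [^] n \<otimes> y)))"
    by (simp add: pow_mult_twisted_commute[OF assms(1-3) yx cy] m_assoc)
  also have "\<dots> = (c [^] ?t \<otimes> c [^] n) \<otimes> ((x [^] n \<otimes> x) \<otimes> (y [^] n \<otimes> y))"
    unfolding xc by (simp add: m_assoc)
  also have "\<dots> = c [^] (Suc n * (Suc n - 1) div 2) \<otimes> (x [^] Suc n \<otimes> y [^] Suc n)"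
    by (simp only: nat_pow_mult[OF assms(3)] t nat_pow_Suc)
  finally show ?case .
qed simp

text \<open>For odd \<open>p\<close> the exponent \<open>p * (p - 1) div 2\<close> is a multiple of
  \<open>p\<close>, so the correction term vanishes.\<close>

lemma (in group) mult_pow_odd_exponent:
  assumes "x \<in> carrier G" "y \<in> carrier G" "c \<in> carrier G"
    and "y \<otimes> x = c \<otimes> (x \<otimes> y)" "c \<otimes> x = x \<otimes> c" "c \<otimes> y = y \<otimes> c"
    and "odd p" "c [^] (p::nat) = \<one>"
  shows "(x \<otimes> y) [^] p = x [^] p \<otimes> y [^] p"
proof -
  obtain k where k: "p = 2 * k + 1"
    using \<open>odd p\<close> by (auto elim: oddE)
  have "p * (p - 1) div 2 = p * k"
    using k by simp
  then have "c [^] (p * (p - 1) div 2) = (c [^] p) [^] k"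
    using assms(3) by (simp only: nat_pow_pow)
  then have "c [^] (p * (p - 1) div 2) = \<one>"
    using assms(8) by simp
  then show ?thesis
    using mult_pow_twisted_commute[OF assms(1-6), of p] assms(1,2) by simp
qed

section \<open>Commuting automorphisms\<close>

lemma autoD:
  assumes "f \<in> auto G"
  shows "f \<in> hom G G" "bij_betw f (carrier G) (carrier G)"
  using assms by (auto simp: auto_def Bij_def)

lemma auto_commute:
  assumes "comm_group (AutoGroup K)" "f \<in> auto K" "g \<in> auto K" "x \<in> carrier K"
  shows "f (g x) = g (f x)"
proof -
  have B: "f \<in> Bij (carrier K)" "g \<in> Bij (carrier K)"
    using assms by (auto simp: auto_def)
  have "f \<otimes>\<^bsub>AutoGroup K\<^esub> g = g \<otimes>\<^bsub>AutoGroup K\<^esub> f"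
    using assms by (intro comm_monoid.m_comm comm_group.axioms) (auto simp: AutoGroup_def)
  then have "compose (carrier K) f g = compose (carrier K) g f"
    using B by (simp add: AutoGroup_def BijGroup_def)
  then have "compose (carrier K) f g x = compose (carrier K) g f x"
    by simp
  then show ?thesis
    using assms(4) by (simp add: compose_def)
qed

lemma (in group) comm_group_AutoGroupI:
  assumes "\<And>f g x. f \<in> auto G \<Longrightarrow> g \<in> auto G \<Longrightarrow> x \<in> carrier G \<Longrightarrow> f (g x) = g (f x)"
  shows "comm_group (AutoGroup G)"
proof (rule group.group_comm_groupI[OF AutoGroup])
  fix f g assume "f \<in> carrier (AutoGroup G)" "g \<in> carrier (AutoGroup G)"
  then have fg: "f \<in> auto G" "g \<in> auto G"
    by (auto simp: AutoGroup_def)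
  then have "f \<in> Bij (carrier G)" "g \<in> Bij (carrier G)"
    by (auto simp: auto_def)
  with fg show "f \<otimes>\<^bsub>AutoGroup G\<^esub> g = g \<otimes>\<^bsub>AutoGroup G\<^esub> f"
    by (auto simp: AutoGroup_def BijGroup_def compose_def assms intro!: restrict_ext)
qed

lemma (in group) conjugation_in_auto:
  assumes g: "g \<in> carrier G"
  shows "conjugation G g (carrier G) \<in> auto G"
proof -
  have "conjugation G g (carrier G) \<in> hom G G"
    using g by (auto simp: hom_def conjugation_def m_assoc mult_inv_cancel)
  moreover have "bij_betw (conjugation G g (carrier G)) (carrier G) (carrier G)"
    by (rule bij_betw_byWitness[where f' = "\<lambda>x. inv g \<otimes> x \<otimes> g"])
      (use g in \<open>auto simp: conjugation_def m_assoc mult_inv_cancel\<close>)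
  ultimately show ?thesis
    by (auto simp: auto_def Bij_def conjugation_def)
qed

text \<open>\<open>f\<close> commutes with conjugation by \<open>x\<close>, while conjugating that
  inner automorphism by \<open>f\<close> gives conjugation by \<open>f x\<close>. So
  \<open>x\<close> and \<open>f x\<close> induce the same inner automorphism and differ by a central
  element.\<close>

lemma (in group) auto_central_if_AutoGroup_comm:
  assumes "comm_group (AutoGroup G)" "f \<in> auto G" and x: "x \<in> carrier G"
  shows "inv x \<otimes> f x \<in> group_center G"
proof -
  interpret f: group_hom G G f
    using autoD(1)[OF assms(2)] by (simp add: group_hom_def group_hom_axioms_def is_group)
  have fx: "f x \<in> carrier G"
    using x by simp
  have comm: "inv x \<otimes> f x \<otimes> y = y \<otimes> (inv x \<otimes> f x)" if y: "y \<in> carrier G" for y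
  proof -
    obtain u where u: "u \<in> carrier G" "f u = y"
      using autoD(2)[OF assms(2)] y by (metis bij_betw_imp_surj_on image_iff)
    have "f (x \<otimes> u \<otimes> inv x) = x \<otimes> f u \<otimes> inv x"
      using auto_commute[OF assms(1,2) conjugation_in_auto[OF x] u(1)] x u(1)
      by (simp add: conjugation_def)
    then have "f x \<otimes> y \<otimes> inv (f x) = x \<otimes> y \<otimes> inv x"
      using x u by simp
    then have "f x \<otimes> y = x \<otimes> y \<otimes> inv x \<otimes> f x"
      using x y fx by (metis inv_solve_right m_closed inv_closed)
    then have "inv x \<otimes> (f x \<otimes> y) = inv x \<otimes> (x \<otimes> (y \<otimes> (inv x \<otimes> f x)))"
      using x y fx by (simp add: m_assoc)
    then show ?thesis
      using x y fx by (simp add: m_assoc[symmetric])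
  qed
  then show ?thesis
    using x fx by (auto simp: group_center_def)
qed


text \<open>\<open>\<psi>\<close> induces an injective endomorphism of the finite quotient, hence an
  automorphism, which is central because it commutes with the inner ones. The centre is the derived
  subgroup of the quotient, whose elements lift to the derived subgroup of \<open>G\<close>; this
  supplies \<open>d\<close>.\<close>

lemma (in normal) hom_to_quotient_central:
  assumes fin: "finite (carrier G)"
    and comm: "comm_group (AutoGroup (G Mod H))"
    and center: "group_center (G Mod H) = derived (G Mod H) (carrier (G Mod H))"
    and hom: "\<psi> \<in> hom G (G Mod H)" and ker: "kernel G (G Mod H) \<psi> = H"
    and x: "x \<in> carrier G"
  shows "\<exists>d\<in>derived G (carrier G). \<psi> x = H #> (x \<otimes> d)"
proof -
  interpret Q: group "G Mod H"
    by (rule factorgroup_is_group)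
  interpret \<psi>: group_hom G "G Mod H" \<psi>
    using hom by (simp add: group_hom_def group_hom_axioms_def is_group Q.is_group)
  interpret r: group_hom G "G Mod H" "\<lambda>a. H #> a"
    using r_coset_hom_Mod by (simp add: group_hom_def group_hom_axioms_def is_group Q.is_group)
  \<comment> \<open>\<open>the_elem\<close> reads off the common value of \<open>\<psi>\<close> on a
    coset, and the restriction makes \<open>F\<close> extensional, as membership in
    \<open>auto\<close> demands.\<close>
  define F where "F = (\<lambda>X\<in>carrier (G Mod H). the_elem (\<psi> ` X))"
  have F_hom: "F \<in> hom (G Mod H) (G Mod H)"
    using \<psi>.FactGroup_hom Q.m_closed[unfolded mult_FactGroup] unfolding ker F_def
    by (auto simp: hom_def Pi_iff)
  have "inj_on F (carrier (G Mod H))"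
    using \<psi>.FactGroup_inj_on unfolding ker F_def by (auto simp: inj_on_def)
  moreover have "finite (carrier (G Mod H))"
    unfolding carrier_FactGroup using fin by simp
  moreover have "F ` carrier (G Mod H) \<subseteq> carrier (G Mod H)"
    using F_hom by (auto simp: hom_def)
  ultimately have "bij_betw F (carrier (G Mod H)) (carrier (G Mod H))"
    by (simp add: bij_betw_def endo_inj_surj)
  then have F: "F \<in> auto (G Mod H)"
    using F_hom by (simp add: auto_def Bij_def F_def)
  have Hx: "H #> x \<in> carrier (G Mod H)"
    using x by simp
  have "\<psi> y = \<psi> x" if y: "y \<in> H #> x" for y
  proof -
    obtain n where n: "n \<in> H" "y = n \<otimes> x"
      using y by (auto simp: r_coset_def)
    then have "n \<in> kernel G (G Mod H) \<psi>"
      by (simp add: ker)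
    then have "n \<in> carrier G" "\<psi> n = \<one>\<^bsub>G Mod H\<^esub>"
      by (auto simp: kernel_def)
    then show ?thesis
      using n(2) x by (simp del: one_FactGroup mult_FactGroup)
  qed
  then have "the_elem (\<psi> ` (H #> x)) = \<psi> x"
    using rcos_self[OF x subgroup_axioms] by (intro the_elem_image_unique) blast+
  then have "F (H #> x) = \<psi> x"
    unfolding F_def by (simp only: restrict_apply' [OF Hx])
  then have "inv\<^bsub>G Mod H\<^esub> (H #> x) \<otimes>\<^bsub>G Mod H\<^esub> \<psi> x \<in> derived (G Mod H) (carrier (G Mod H))"
    using Q.auto_central_if_AutoGroup_comm[OF comm F Hx] center by simp
  also have "\<dots> = (\<lambda>a. H #> a) ` derived G (carrier G)"
    unfolding carrier_FactGroup by (rule r.derived_img) simp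
  finally obtain d where d: "d \<in> derived G (carrier G)"
    and eq: "inv\<^bsub>G Mod H\<^esub> (H #> x) \<otimes>\<^bsub>G Mod H\<^esub> \<psi> x = H #> d"
    by auto
  have dG: "d \<in> carrier G"
    using d derived_in_carrier by blast
  have "\<psi> x = (H #> x) \<otimes>\<^bsub>G Mod H\<^esub> (H #> d)"
    unfolding eq[symmetric] using Hx x
    by (simp del: mult_FactGroup one_FactGroup add: Q.m_assoc[symmetric])
  also have "\<dots> = H #> (x \<otimes> d)"
    unfolding mult_FactGroup by (rule rcos_sum[OF x dG])
  finally show ?thesis
    using d by (rule bexI)
qed

section \<open>Extensions of a class two group by a central automorphism\<close>

text \<open>The facts about the special group \<open>H\<close> are phrased with the operations of
  \<open>G\<close>, so that no subgroup record appears. \<open>center_H\<close> says Z(H) = H', and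
  by it centrality of the action of \<open>w\<close> becomes a condition on
  \<open>derived G H\<close>.\<close>

locale class_two_extension = normal H G for H and G (structure) +
  fixes p :: nat and w
  assumes prime_p: "prime p" and odd_p: "odd p"
    and center_H: "{z \<in> H. \<forall>x\<in>H. z \<otimes> x = x \<otimes> z} = derived G H"
    and pow_in_derived: "x \<in> H \<Longrightarrow> x [^] p \<in> derived G H"
    and w_closed [simp]: "w \<in> carrier G"
    and w_acts_centrally: "x \<in> H \<Longrightarrow> w \<otimes> x \<otimes> inv w \<otimes> inv x \<in> derived G H"
    and carrier_decomp: "g \<in> carrier G \<Longrightarrow> \<exists>x\<in>H. \<exists>i::nat. g = x \<otimes> w [^] i"
begin

abbreviation D where "D \<equiv> derived G H"

lemma D_subgroup: "subgroup D G"
  by (simp add: derived_is_subgroup subset)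

lemma D_in_H: "d \<in> D \<Longrightarrow> d \<in> H"
  using center_H by blast

lemma D_closed [simp]: "d \<in> D \<Longrightarrow> d \<in> carrier G"
  using D_in_H by simp

lemma D_commute_H: "d \<in> D \<Longrightarrow> x \<in> H \<Longrightarrow> d \<otimes> x = x \<otimes> d"
  using center_H by blast

lemma D_mult [simp]: "d \<in> D \<Longrightarrow> e \<in> D \<Longrightarrow> d \<otimes> e \<in> D"
  using D_subgroup by (rule subgroup.m_closed)

lemma D_inv [simp]: "d \<in> D \<Longrightarrow> inv d \<in> D"
  using D_subgroup by (rule subgroup.m_inv_closed)

lemma D_pow [simp]: "d \<in> D \<Longrightarrow> d [^] (n::nat) \<in> D"
  by (induction n) (simp_all add: subgroup.one_closed[OF D_subgroup])

lemma H_pow: "x \<in> H \<Longrightarrow> x [^] (n::nat) \<in> H"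
  by (induction n) simp_all

text \<open>Reduces claims about H' to commutators: the exponent of \<open>D\<close>,
  \<open>w\<close> centralising \<open>D\<close>, and automorphisms fixing \<open>D\<close> are all
  obtained this way.\<close>

lemma D_leI:
  assumes "subgroup S G" "\<And>x y. x \<in> H \<Longrightarrow> y \<in> H \<Longrightarrow> x \<otimes> y \<otimes> inv x \<otimes> inv y \<in> S"
  shows "D \<subseteq> S"
  unfolding derived_def using assms by (intro generate_subgroup_incl) auto

lemma commutator_in_D: "x \<in> H \<Longrightarrow> y \<in> H \<Longrightarrow> x \<otimes> y \<otimes> inv x \<otimes> inv y \<in> D"
  unfolding derived_def by (auto intro!: generate.incl)

lemma commutator_twist:
  assumes "x \<in> carrier G" "y \<in> carrier G"
  shows "y \<otimes> x = (y \<otimes> x \<otimes> inv y \<otimes> inv x) \<otimes> (x \<otimes> y)"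
proof -
  have "inv y \<otimes> (inv x \<otimes> (x \<otimes> y)) = \<one>"
    using assms by (simp add: m_assoc[symmetric] inv_mult_group[symmetric])
  then show ?thesis
    using assms by (simp add: m_assoc)
qed

text \<open>Since \<open>y [^] p\<close> lies in \<open>D\<close> and so is central in
  \<open>H\<close>, a commutator satisfies \<open>[y, x]^p = [y^p, x] = 1\<close>. This extends to
  all of \<open>D\<close> because \<open>D\<close> is abelian.\<close>

lemma D_exponent:
  assumes "d \<in> D" shows "d [^] p = \<one>"
proof -
  have "subgroup {d \<in> D. d [^] p = \<one>} G"
  proof (rule subgroupI)
    fix d e assume "d \<in> {d \<in> D. d [^] p = \<one>}" "e \<in> {d \<in> D. d [^] p = \<one>}"
    then show "d \<otimes> e \<in> {d \<in> D. d [^] p = \<one>}"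
      using pow_mult_distrib[of d e p] D_commute_H[of d e] D_in_H by simp
  qed (auto simp: nat_pow_inv intro!: exI[of _ \<one>] subgroup.one_closed[OF D_subgroup])
  moreover have "y \<otimes> x \<otimes> inv y \<otimes> inv x \<in> {d \<in> D. d [^] p = \<one>}" if xy: "y \<in> H" "x \<in> H" for x y
  proof -
    let ?c = "y \<otimes> x \<otimes> inv y \<otimes> inv x"
    have c: "?c \<in> D"
      using commutator_in_D[OF xy] .
    have "?c [^] p \<otimes> (x \<otimes> y [^] p) = y [^] p \<otimes> x"
      using xy c by (intro pow_mult_twisted_commute[symmetric] commutator_twist D_commute_H) simp_all
    also have "\<dots> = \<one> \<otimes> (x \<otimes> y [^] p)"
      using D_commute_H[OF pow_in_derived] xy by simp
    finally have "?c [^] p = \<one>"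
      by (subst (asm) right_cancel) (use c xy in simp_all)
    then show ?thesis
      using c by simp
  qed
  ultimately have "D \<subseteq> {d \<in> D. d [^] p = \<one>}"
    by (rule D_leI)
  then show ?thesis
    using assms by blast
qed

section \<open>Action of \<open>w\<close> on \<open>H\<close> and the centre of
  \<open>G\<close>\<close>

lemma w_twist:
  assumes "x \<in> H" obtains d where "d \<in> D" "w \<otimes> x = d \<otimes> (x \<otimes> w)"
  using commutator_twist[OF mem_carrier[OF assms] w_closed] w_acts_centrally[OF assms] by blast

text \<open>Conjugation by \<open>w\<close> multiplies \<open>x\<close> and \<open>y\<close> by
  elements of \<open>D\<close>, which are central in \<open>H\<close> and cancel from the commutator
  \<open>c\<close>. To avoid inverses, \<open>w \<otimes> (y \<otimes> x)\<close> is compared with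
  \<open>c \<otimes> (w \<otimes> (x \<otimes> y))\<close>.\<close>

lemma D_commute_w:
  assumes "d \<in> D" shows "d \<otimes> w = w \<otimes> d"
proof -
  let ?C = "{c \<in> carrier G. w \<otimes> c = c \<otimes> w}"
  have "subgroup ?C G"
  proof (rule subgroupI)
    fix a assume a: "a \<in> ?C"
    then have ac: "a \<in> carrier G" and eq: "w \<otimes> a = a \<otimes> w"
      by simp_all
    have "inv a \<otimes> (w \<otimes> a) \<otimes> inv a = inv a \<otimes> w"
      using ac by (simp add: m_assoc)
    moreover have "inv a \<otimes> (a \<otimes> w) \<otimes> inv a = w \<otimes> inv a"
      using ac by (simp flip: m_assoc)
    ultimately have "inv a \<otimes> w = w \<otimes> inv a"
      by (simp only: eq)
    with a show "inv a \<in> ?C"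
      by simp
  next
    fix a b assume ab: "a \<in> ?C" "b \<in> ?C"
    then have "a \<in> carrier G" "b \<in> carrier G" "w \<otimes> a = a \<otimes> w"
      by auto
    then have "w \<otimes> (a \<otimes> b) = a \<otimes> (w \<otimes> b)"
      by (simp flip: m_assoc)
    also have "w \<otimes> b = b \<otimes> w"
      using ab by simp
    finally show "a \<otimes> b \<in> ?C"
      using ab by (simp add: m_assoc)
  qed auto
  moreover have "y \<otimes> x \<otimes> inv y \<otimes> inv x \<in> ?C" if xy: "y \<in> H" "x \<in> H" for x y
  proof -
    define c where "c = y \<otimes> x \<otimes> inv y \<otimes> inv x"
    have c: "c \<in> D" and yx: "y \<otimes> x = c \<otimes> (x \<otimes> y)"
      using commutator_in_D[OF xy] commutator_twist[of x y] xy by (simp_all add: c_def)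
    obtain e where e: "e \<in> D" "w \<otimes> y = e \<otimes> (y \<otimes> w)"
      using w_twist xy by blast
    obtain f where f: "f \<in> D" "w \<otimes> x = f \<otimes> (x \<otimes> w)"
      using w_twist xy by blast
    have [simp]: "x \<in> carrier G" "y \<in> carrier G" "c \<in> carrier G" "e \<in> carrier G" "f \<in> carrier G"
      using xy c e f by auto
    have 1: "w \<otimes> (y \<otimes> x) = e \<otimes> f \<otimes> (y \<otimes> x) \<otimes> w" if yx: "y \<in> H" "x \<in> H" "e \<in> D" "f \<in> D"
      "w \<otimes> y = e \<otimes> (y \<otimes> w)" "w \<otimes> x = f \<otimes> (x \<otimes> w)" for x y e f
    proof -
      have [simp]: "x \<in> carrier G" "y \<in> carrier G" "e \<in> carrier G" "f \<in> carrier G"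
        using yx by auto
      have "w \<otimes> (y \<otimes> x) = e \<otimes> y \<otimes> (w \<otimes> x)"
        by (simp add: yx(5) m_assoc flip: m_assoc[of w y x])
      also have "\<dots> = e \<otimes> (y \<otimes> f) \<otimes> (x \<otimes> w)"
        by (simp add: yx(6) m_assoc)
      also have "y \<otimes> f = f \<otimes> y"
        by (rule D_commute_H[symmetric]) (use yx in simp_all)
      finally show ?thesis
        by (simp add: m_assoc)
    qed
    have "(w \<otimes> c) \<otimes> (x \<otimes> y) = w \<otimes> (y \<otimes> x)"
      by (simp add: yx m_assoc)
    also have "\<dots> = e \<otimes> f \<otimes> c \<otimes> (x \<otimes> y) \<otimes> w"
      using 1[of y x e f] xy e f by (simp add: yx m_assoc)
    also have "e \<otimes> f \<otimes> c = c \<otimes> (f \<otimes> e)"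
      using D_commute_H[OF c] D_commute_H[of e f] D_in_H e f by simp
    also have "c \<otimes> (f \<otimes> e) \<otimes> (x \<otimes> y) \<otimes> w = c \<otimes> (f \<otimes> e \<otimes> (x \<otimes> y) \<otimes> w)"
      by (simp add: m_assoc)
    also have "\<dots> = c \<otimes> (w \<otimes> (x \<otimes> y))"
      using 1[of x y f e] xy e f by simp
    also have "\<dots> = (c \<otimes> w) \<otimes> (x \<otimes> y)"
      by (simp add: m_assoc)
    finally have "w \<otimes> c = c \<otimes> w"
      by simp
    then show ?thesis
      by (simp add: c_def[symmetric])
  qed
  ultimately have "D \<subseteq> ?C"
    by (rule D_leI)
  then show ?thesis
    using assms by auto
qed

lemma centerI:
  assumes "z \<in> carrier G" "z \<otimes> w = w \<otimes> z" "\<And>x. x \<in> H \<Longrightarrow> z \<otimes> x = x \<otimes> z"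
  shows "z \<in> group_center G"
proof -
  have "z \<otimes> g = g \<otimes> z" if g: "g \<in> carrier G" for g
  proof -
    obtain x i where x: "x \<in> H" "g = x \<otimes> w [^] (i::nat)"
      using carrier_decomp g by blast
    have "w [^] i \<otimes> z = z \<otimes> w [^] i"
      using group_commutes_pow[of w z i] assms by simp
    then have "g \<otimes> z = (x \<otimes> z) \<otimes> w [^] i"
      using x assms(1) by (simp add: m_assoc)
    also have "\<dots> = z \<otimes> g"
      unfolding assms(3)[OF x(1), symmetric] using x assms(1) by (simp add: m_assoc)
    finally show ?thesis ..
  qed
  then show ?thesis
    using assms(1) by (simp add: group_center_def)
qed

lemma center_closed: "z \<in> group_center G \<Longrightarrow> z \<in> carrier G"
  and center_commute: "z \<in> group_center G \<Longrightarrow> g \<in> carrier G \<Longrightarrow> g \<otimes> z = z \<otimes> g"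
  by (simp_all add: group_center_def)

lemma center_lcomm:
  assumes "z \<in> group_center G" "g \<in> carrier G" "h \<in> carrier G"
  shows "g \<otimes> (z \<otimes> h) = z \<otimes> (g \<otimes> h)"
proof -
  have "g \<otimes> (z \<otimes> h) = (g \<otimes> z) \<otimes> h"
    using assms center_closed by (simp add: m_assoc)
  also have "g \<otimes> z = z \<otimes> g"
    by (rule center_commute[OF assms(1,2)])
  finally show ?thesis
    using assms center_closed by (simp add: m_assoc)
qed

lemma D_in_center: "d \<in> D \<Longrightarrow> d \<in> group_center G"
  by (rule centerI) (simp_all add: D_commute_w D_commute_H)

text \<open>A single \<open>d\<close>, the commutator of \<open>w\<close> and \<open>x\<close>,
  serves all exponents \<open>i\<close>.\<close>

lemma w_pow_twist:
  assumes "x \<in> H"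
  obtains d where "d \<in> D" "\<And>i::nat. w [^] i \<otimes> x = d [^] i \<otimes> (x \<otimes> w [^] i)"
proof -
  obtain d where d: "d \<in> D" "w \<otimes> x = d \<otimes> (x \<otimes> w)"
    using w_twist assms by blast
  show ?thesis
    by (rule that[OF d(1)]) (use assms d D_commute_w in \<open>simp add: pow_mult_twisted_commute\<close>)
qed

text \<open>\<open>[w^p, x] = [w, x]^p\<close>, which is trivial since \<open>D\<close> has exponent
  \<open>p\<close>.\<close>

lemma w_pow_p_in_center: "w [^] p \<in> group_center G"
proof (rule centerI)
  fix x assume x: "x \<in> H"
  obtain d where "d \<in> D" "\<And>i::nat. w [^] i \<otimes> x = d [^] i \<otimes> (x \<otimes> w [^] i)"
    using w_pow_twist x by blast
  then show "w [^] p \<otimes> x = x \<otimes> w [^] p"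
    using x by (simp add: D_exponent)
next
  show "w [^] p \<otimes> w = w \<otimes> w [^] p"
    using nat_pow_Suc2[OF w_closed, of p] by simp
qed simp

text \<open>The commutator of \<open>w [^] i\<close> and \<open>x\<close> is \<open>d [^] i\<close>,
  central and killed by \<open>p\<close>, so the formula for odd exponents applies.\<close>

lemma mult_pow_p:
  assumes x: "x \<in> H"
  shows "(x \<otimes> w [^] i) [^] p = x [^] p \<otimes> w [^] (i * p)"
proof -
  obtain d where d: "d \<in> D" "\<And>i::nat. w [^] i \<otimes> x = d [^] i \<otimes> (x \<otimes> w [^] i)"
    using w_pow_twist x by blast
  have c: "d [^] i \<in> D"
    using d by simp
  have comm: "d [^] i \<otimes> g = g \<otimes> d [^] i" if "g \<in> carrier G" for g
    using center_commute[OF D_in_center[OF c] that] ..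
  have "(x \<otimes> w [^] i) [^] p = x [^] p \<otimes> (w [^] i) [^] p"
    by (rule mult_pow_odd_exponent[OF _ _ _ d(2)[of i] comm comm odd_p D_exponent[OF c]])
      (use x c in simp_all)
  then show ?thesis
    by (simp add: nat_pow_pow)
qed

text \<open>G/H is cyclic, generated by the image of \<open>w\<close>. Concretely,
  \<open>a \<otimes> b\<close> and \<open>b \<otimes> a\<close> end in the same power of
  \<open>w\<close>, which cancels in the commutator.\<close>

lemma derived_carrier_subset: "derived G (carrier G) \<subseteq> H"
  unfolding derived_def
proof (rule generate_subgroup_incl[OF _ subgroup_axioms], clarsimp)
  fix a b assume a: "a \<in> carrier G" and b: "b \<in> carrier G"
  obtain x i where x: "x \<in> H" "a = x \<otimes> w [^] (i::nat)"
    using carrier_decomp a by blast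
  obtain y j where y: "y \<in> H" "b = y \<otimes> w [^] (j::nat)"
    using carrier_decomp b by blast
  have *: "\<exists>h\<in>H. (x \<otimes> w [^] i) \<otimes> (y \<otimes> w [^] j) = h \<otimes> w [^] (i + j)" if x: "x \<in> H" and y: "y \<in> H"
    for x y and i j :: nat
  proof -
    obtain d where d: "d \<in> D" "\<And>i::nat. w [^] i \<otimes> y = d [^] i \<otimes> (y \<otimes> w [^] i)"
      using w_pow_twist y by blast
    have "(x \<otimes> w [^] i) \<otimes> (y \<otimes> w [^] j) = x \<otimes> (w [^] i \<otimes> y) \<otimes> w [^] j"
      using x y by (simp add: m_assoc)
    also have "\<dots> = (x \<otimes> (d [^] i \<otimes> y)) \<otimes> w [^] (i + j)"
      using x y d by (simp add: m_assoc flip: nat_pow_mult)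
    finally show ?thesis
      using x y d D_in_H[of "d [^] i"] by auto
  qed
  obtain h where h: "h \<in> H" "a \<otimes> b = h \<otimes> w [^] (i + j)"
    using *[OF x(1) y(1)] x y by blast
  obtain k where k: "k \<in> H" "b \<otimes> a = k \<otimes> w [^] (i + j)"
    using *[OF y(1) x(1), of j i] x y by (auto simp: add.commute)
  have "a \<otimes> b \<otimes> inv a \<otimes> inv b = (a \<otimes> b) \<otimes> inv (b \<otimes> a)"
    using a b by (simp add: inv_mult_group m_assoc)
  also have "\<dots> = h \<otimes> inv k"
    unfolding h(2) k(2) using h(1) k(1) by (simp add: inv_mult_group m_assoc mult_inv_cancel)
  finally show "a \<otimes> b \<otimes> inv a \<otimes> inv b \<in> H"
    using h(1) k(1) by simp
qed

end

section \<open>The amalgamated product\<close>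

text \<open>\<open>pow_one_in_derived\<close> expresses injectivity of the power map on H/H';
  \<open>w_pow_in_H\<close> and \<open>M_cyclic\<close> express that \<open>M\<close> is the
  intersection of \<open>H\<close> with the powers of \<open>w\<close>; \<open>M_pow\<close> encodes
  that \<open>M\<close> has order \<open>p\<close> and is not contained in H^p.\<close>

locale miller_amalgam = class_two_extension +
  fixes M
  assumes finite_H: "finite H"
    and pow_one_in_derived: "x \<in> H \<Longrightarrow> x [^] p = \<one> \<Longrightarrow> x \<in> derived G H"
    and M_subgroup: "subgroup M G"
    and M_subset_D: "M \<subseteq> derived G H"
    and omega_subset_M: "w [^] (i * p) = \<one> \<Longrightarrow> w [^] i \<in> M"
    and w_pow_in_H: "w [^] i \<in> H \<Longrightarrow> w [^] i \<in> M"
    and M_cyclic: "m \<in> M \<Longrightarrow> \<exists>i::nat. m = w [^] i"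
    and M_pow: "x \<in> H \<Longrightarrow> x [^] p \<in> M \<Longrightarrow> x [^] p = \<one>"
    and ord_w: "p ^ 3 dvd ord w" "ord w \<noteq> 0"
    and w_not_inner: "g \<in> H \<Longrightarrow> \<exists>x\<in>H. w \<otimes> x \<otimes> inv w \<noteq> g \<otimes> x \<otimes> inv g"
    and quotient_auto_comm: "comm_group (AutoGroup (G\<lparr>carrier := H\<rparr> Mod M))"
    and quotient_center: "group_center (G\<lparr>carrier := H\<rparr> Mod M) =
      derived (G\<lparr>carrier := H\<rparr> Mod M) (carrier (G\<lparr>carrier := H\<rparr> Mod M))"
begin

abbreviation v where "v \<equiv> w [^] p"

lemma p_pos: "p > 0"
  using prime_p by (rule prime_gt_0_nat)

lemma M_D: "m \<in> M \<Longrightarrow> m \<in> D"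
  using M_subset_D by blast

lemma M_H: "m \<in> M \<Longrightarrow> m \<in> H"
  using M_D D_in_H by blast

lemma M_closed: "m \<in> M \<Longrightarrow> m \<in> carrier G"
  using M_H by simp

section \<open>Elements of order \<open>p\<close> and factorisations modulo \<open>M\<close>\<close>

lemma v_center: "v [^] (n::nat) \<in> group_center G"
proof -
  have "v [^] n \<otimes> g = g \<otimes> v [^] n" if "g \<in> carrier G" for g
    by (rule group_commutes_pow) (use that center_commute[OF w_pow_p_in_center that] in simp_all)
  then show ?thesis
    unfolding group_center_def by simp
qed

text \<open>With \<open>g = x \<otimes> w [^] i\<close>, the element \<open>w [^] (i * p)\<close> is
  a \<open>p\<close>-th power from \<open>H\<close> and lies in \<open>M\<close>, hence is trivial
  by \<open>M_pow\<close>; both factors of \<open>g\<close> then lie in \<open>D\<close>. Together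
  with \<open>D_exponent\<close> this describes \<open>D\<close> by the equation
  \<open>g [^] p = \<one>\<close>, which automorphisms preserve.\<close>

lemma pow_p_one_in_D:
  assumes "g \<in> carrier G" "g [^] p = \<one>" shows "g \<in> D"
proof -
  obtain x i where x: "x \<in> H" and g: "g = x \<otimes> w [^] (i::nat)"
    using carrier_decomp assms(1) by blast
  have "x [^] p \<otimes> w [^] (i * p) = \<one>"
    using assms(2) mult_pow_p[OF x, of i] by (simp add: g)
  then have "inv (w [^] (i * p)) = x [^] p"
    using x by (intro inv_equality) simp_all
  then have "w [^] (i * p) = inv (x [^] p)"
    by (metis inv_inv nat_pow_closed w_closed)
  then have *: "w [^] (i * p) = inv x [^] p"
    using x by (simp add: nat_pow_inv)
  then have "w [^] (i * p) \<in> H"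
    using x by (simp add: H_pow)
  then have "w [^] (i * p) = \<one>"
    using M_pow[of "inv x"] w_pow_in_H[of "i * p"] x * by simp
  moreover from this have "x [^] p = \<one>"
    using \<open>x [^] p \<otimes> w [^] (i * p) = \<one>\<close> x by simp
  ultimately show ?thesis
    using pow_one_in_derived[OF x] omega_subset_M M_D by (simp add: g)
qed

lemma w_pow_quotient_in_M:
  assumes q: "q \<in> H" "q \<otimes> w [^] (i::nat) = w [^] (j::nat)"
  shows "q \<in> M"
proof -
  let ?n = "ord w"
  \<comment> \<open>Exponents are natural numbers, so \<open>w [^] (i * (?n - 1))\<close> serves as
    the inverse of \<open>w [^] i\<close>.\<close>
  have "w [^] i \<otimes> w [^] (i * (?n - 1)) = w [^] (?n * i)"
    using ord_w(2) by (cases ?n) (simp_all add: nat_pow_mult mult.commute)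
  also have "\<dots> = \<one>"
    by (simp add: nat_pow_pow[symmetric])
  finally have 1: "w [^] i \<otimes> w [^] (i * (?n - 1)) = \<one>" .
  have "q = q \<otimes> (w [^] i \<otimes> w [^] (i * (?n - 1)))"
    using q(1) by (simp only: 1) simp
  also have "\<dots> = (q \<otimes> w [^] i) \<otimes> w [^] (i * (?n - 1))"
    using q(1) by (simp add: m_assoc)
  also have "\<dots> = w [^] (j + i * (?n - 1))"
    by (simp add: q(2) nat_pow_mult)
  finally show ?thesis
    using q(1) w_pow_in_H by metis
qed

lemma decomp_unique_mod_M:
  assumes ab: "a \<in> H" "b \<in> H" "a \<otimes> v [^] (i::nat) = b \<otimes> v [^] (j::nat)"
  obtains m where "m \<in> M" "a = m \<otimes> b"
proof -
  let ?q = "inv b \<otimes> a"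
  have "?q \<otimes> v [^] i = inv b \<otimes> (b \<otimes> v [^] j)"
    using ab(1,2) by (simp add: m_assoc flip: ab(3))
  also have "\<dots> = v [^] j"
    using ab by (simp add: mult_inv_cancel)
  finally have "?q \<in> M"
    using ab w_pow_quotient_in_M[of ?q "p * i" "p * j"] by (simp add: nat_pow_pow)
  moreover have "a = b \<otimes> ?q"
    using ab by (simp add: mult_inv_cancel)
  moreover have "?q \<otimes> b = b \<otimes> ?q"
    using \<open>?q \<in> M\<close> ab by (intro D_commute_H M_D)
  ultimately show ?thesis
    using that by metis
qed

text \<open>If \<open>m = w [^] k\<close>, then \<open>m [^] p = \<one>\<close> makes
  \<open>p ^ 3\<close> divide \<open>k * p\<close>. The large order of \<open>w\<close> thus puts
  \<open>M\<close> inside the powers of \<open>v [^] p\<close>.\<close>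

lemma M_as_v_pow:
  assumes "m \<in> M" obtains l :: nat where "m = v [^] (p * l)"
proof -
  obtain k where k: "m = w [^] (k::nat)"
    using M_cyclic assms by blast
  have "w [^] (k * p) = \<one>"
    using D_exponent[OF M_D[OF assms]] by (simp add: k nat_pow_pow)
  then have "p ^ 3 dvd k * p"
    using ord_w(1) by (simp add: pow_eq_id) (meson dvd_trans)
  then have "p * p dvd k"
    using p_pos by (simp add: power3_eq_cube)
  then obtain l where "k = p * p * l" ..
  then have "m = v [^] (p * l)"
    by (simp add: k nat_pow_pow mult.assoc)
  then show ?thesis ..
qed

section \<open>Action of a single automorphism \<open>\<alpha>\<close> of \<open>G\<close>\<close>

context
  fixes \<alpha> assumes alpha: "\<alpha> \<in> auto G"
begin

interpretation \<alpha>: group_hom G G \<alpha>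
  using autoD(1)[OF alpha] by (simp add: group_hom_def group_hom_axioms_def is_group)

lemma auto_inj: "x \<in> carrier G \<Longrightarrow> y \<in> carrier G \<Longrightarrow> \<alpha> x = \<alpha> y \<Longrightarrow> x = y"
  using autoD(2)[OF alpha] by (auto simp: bij_betw_def inj_on_def)

lemma auto_D: "d \<in> D \<Longrightarrow> \<alpha> d \<in> D"
  using D_exponent[of d] \<alpha>.hom_nat_pow[of d p] by (intro pow_p_one_in_D) auto

text \<open>\<open>\<alpha> x [^] p\<close> lies in \<open>D\<close>, which forces
  \<open>w [^] (i * p)\<close> into \<open>D\<close> and hence
  \<open>w [^] (i * p * p) = \<one>\<close>. As \<open>p ^ 3\<close> divides the order of
  \<open>w\<close>, \<open>p\<close> divides \<open>i\<close>.\<close>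

lemma auto_H_decomp:
  assumes x: "x \<in> H"
  shows "\<exists>t\<in>H. \<exists>j::nat. \<alpha> x = t \<otimes> v [^] j"
proof -
  obtain t i where t: "t \<in> H" and ax: "\<alpha> x = t \<otimes> w [^] (i::nat)"
    using carrier_decomp x by (metis \<alpha>.hom_closed mem_carrier)
  have "t [^] p \<otimes> w [^] (i * p) = \<alpha> (x [^] p)"
    using x mult_pow_p[OF t] by (simp add: \<alpha>.hom_nat_pow ax)
  then have "t [^] p \<otimes> w [^] (i * p) \<in> D"
    using auto_D pow_in_derived x by simp
  then have "inv (t [^] p) \<otimes> (t [^] p \<otimes> w [^] (i * p)) \<in> D"
    using pow_in_derived[OF t] by simp
  then have "w [^] (i * p) \<in> D"
    using t by (simp add: mult_inv_cancel)
  then have "w [^] (i * p * p) = \<one>"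
    using D_exponent by (simp add: nat_pow_pow[symmetric])
  then have "p ^ 3 dvd i * p * p"
    using ord_w(1) by (simp add: pow_eq_id) (meson dvd_trans)
  then have "p dvd i"
    using p_pos by (simp add: power3_eq_cube)
  then obtain j where "i = p * j" ..
  then show ?thesis
    using t ax by (auto simp: nat_pow_pow)
qed

text \<open>\<open>m\<close> is a power of \<open>v [^] p\<close>, and the \<open>H\<close>-part
  \<open>g\<close> of \<open>\<alpha> w\<close> disappears on taking \<open>p\<close>-th powers
  twice. So \<open>\<alpha> m\<close> is a power of \<open>w\<close> that lies in \<open>H\<close>,
  hence in \<open>M\<close>.\<close>

lemma auto_M:
  assumes m: "m \<in> M" shows "\<alpha> m \<in> M"
proof -
  obtain l where l: "m = v [^] (p * l)"
    using M_as_v_pow m by blast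
  obtain g i where g: "g \<in> H" and aw: "\<alpha> w = g \<otimes> w [^] (i::nat)"
    using carrier_decomp \<alpha>.hom_closed w_closed by blast
  have "(\<alpha> w [^] p) [^] p = (g [^] p) [^] p \<otimes> w [^] (i * p * p)"
    using g by (simp add: aw mult_pow_p H_pow)
  also have "\<dots> = w [^] (i * p * p)"
    using g by (simp add: D_exponent pow_in_derived)
  finally have "\<alpha> m = w [^] (i * p * p * l)"
    by (simp add: l \<alpha>.hom_nat_pow flip: nat_pow_pow)
  moreover have "\<alpha> m \<in> H"
    using auto_D M_D m D_in_H by blast
  ultimately show ?thesis
    using w_pow_in_H by metis
qed

lemma auto_M_iff:
  assumes "x \<in> carrier G" shows "\<alpha> x \<in> M \<longleftrightarrow> x \<in> M"
proof
  have "finite M"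
    using finite_H M_H by (meson finite_subset subsetI)
  moreover have "inj_on \<alpha> M"
    using auto_inj M_closed by (auto simp: inj_on_def)
  ultimately have "\<alpha> ` M = M"
    using auto_M by (intro endo_inj_surj) auto
  moreover assume "\<alpha> x \<in> M"
  ultimately obtain m where "m \<in> M" "\<alpha> m = \<alpha> x"
    by (metis imageE)
  then show "x \<in> M"
    using auto_inj[of m x] assms M_closed by auto
qed (rule auto_M)

lemma auto_preimage_center:
  assumes x: "x \<in> carrier G" and "\<alpha> x \<in> group_center G" shows "x \<in> group_center G"
proof -
  have "x \<otimes> y = y \<otimes> x" if y: "y \<in> carrier G" for y
  proof (rule auto_inj)
    have "\<alpha> x \<otimes> \<alpha> y = \<alpha> y \<otimes> \<alpha> x"
      using center_commute[OF assms(2), of "\<alpha> y"] y by simp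
    then show "\<alpha> (x \<otimes> y) = \<alpha> (y \<otimes> x)"
      unfolding \<alpha>.hom_mult[OF x y] \<alpha>.hom_mult[OF y x] .
  qed (use x y in simp_all)
  then show ?thesis
    using x by (simp add: group_center_def)
qed

text \<open>If \<open>\<alpha>(x) = \<tau>(x) v\<^sup>j\<close> with \<open>\<tau>(x) \<in> H\<close>, then \<open>\<tau>(x)\<close> is determined modulo \<open>M\<close>, and \<open>x \<mapsto> \<tau>(x)M\<close>
  is a homomorphism from \<open>H\<close> to \<open>H/M\<close> with kernel \<open>M\<close>.\<close>
lemma auto_H_central:
  assumes x: "x \<in> H"
  shows "\<exists>d\<in>D. \<exists>j::nat. \<alpha> x = d \<otimes> v [^] j \<otimes> x"
proof -
  let ?K = "G\<lparr>carrier := H\<rparr>"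
  interpret K: group ?K
    by (rule subgroup_imp_group[OF subgroup_axioms])
  have "subgroup M ?K"
    using M_subgroup M_H subgroup_incl[OF M_subgroup subgroup_axioms] by auto
  then interpret MK: normal M ?K
    using M_D D_commute_H by (intro K.normalI) (auto simp: r_coset_def l_coset_def)
  obtain \<tau> where \<tau>: "\<And>x. x \<in> H \<Longrightarrow> \<tau> x \<in> H" "\<And>x. x \<in> H \<Longrightarrow> \<exists>j::nat. \<alpha> x = \<tau> x \<otimes> v [^] j"
    using auto_H_decomp by metis
  define \<psi> where "\<psi> x = M #>\<^bsub>?K\<^esub> \<tau> x" for x
  have absorb: "M #>\<^bsub>?K\<^esub> (m \<otimes> y) = M #>\<^bsub>?K\<^esub> y" if "m \<in> M" "y \<in> H" for m y
    using K.coset_mult_assoc[of M m y] K.coset_join2[of m M] MK.subgroup_axioms MK.subset that M_H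
    by simp
  have "\<psi> \<in> hom ?K (?K Mod M)"
  proof (rule homI)
    fix x assume "x \<in> carrier ?K"
    then show "\<psi> x \<in> carrier (?K Mod M)"
      using \<tau> by (auto simp: \<psi>_def carrier_FactGroup)
  next
    fix x y assume "x \<in> carrier ?K" "y \<in> carrier ?K"
    then have xy: "x \<in> H" "y \<in> H" "x \<otimes> y \<in> H"
      by simp_all
    obtain a b c where abc: "\<alpha> x = \<tau> x \<otimes> v [^] (a::nat)" "\<alpha> y = \<tau> y \<otimes> v [^] (b::nat)"
      "\<alpha> (x \<otimes> y) = \<tau> (x \<otimes> y) \<otimes> v [^] (c::nat)"
      using \<tau>(2)[OF xy(1)] \<tau>(2)[OF xy(2)] \<tau>(2)[OF xy(3)] by blast
    have [simp]: "\<tau> x \<in> carrier G" "\<tau> y \<in> carrier G"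
      using \<tau>(1) xy by simp_all
    have "\<tau> (x \<otimes> y) \<otimes> v [^] c = \<alpha> x \<otimes> \<alpha> y"
      using xy by (simp flip: abc(3))
    also have "\<dots> = \<tau> x \<otimes> (v [^] a \<otimes> (\<tau> y \<otimes> v [^] b))"
      by (simp add: abc(1,2) m_assoc)
    also have "v [^] a \<otimes> (\<tau> y \<otimes> v [^] b) = \<tau> y \<otimes> (v [^] a \<otimes> v [^] b)"
      by (rule center_lcomm[OF v_center, symmetric]) simp_all
    also have "\<tau> x \<otimes> (\<tau> y \<otimes> (v [^] a \<otimes> v [^] b)) = (\<tau> x \<otimes> \<tau> y) \<otimes> v [^] (a + b)"
      by (simp add: m_assoc nat_pow_mult)
    finally obtain m where "m \<in> M" "\<tau> (x \<otimes> y) = m \<otimes> (\<tau> x \<otimes> \<tau> y)"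
      using decomp_unique_mod_M[of "\<tau> (x \<otimes> y)" "\<tau> x \<otimes> \<tau> y"] \<tau>(1)[OF xy(1)] \<tau>(1)[OF xy(2)] \<tau>(1)[OF xy(3)]
      by auto
    then show "\<psi> (x \<otimes>\<^bsub>?K\<^esub> y) = \<psi> x \<otimes>\<^bsub>?K Mod M\<^esub> \<psi> y"
      using absorb[of m "\<tau> x \<otimes> \<tau> y"] MK.rcos_sum[of "\<tau> x" "\<tau> y"] \<tau>(1)[OF xy(1)] \<tau>(1)[OF xy(2)]
      by (simp add: \<psi>_def)
  qed
  moreover have "kernel ?K (?K Mod M) \<psi> = M"
  proof -
    have "M #>\<^bsub>?K\<^esub> \<tau> x = M \<longleftrightarrow> x \<in> M" if x: "x \<in> H" for x
    proof -
      have "M #>\<^bsub>?K\<^esub> \<tau> x = M \<longleftrightarrow> \<tau> x \<in> M"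
      proof
        show "\<tau> x \<in> M" if "M #>\<^bsub>?K\<^esub> \<tau> x = M"
          by (rule K.coset_join1[OF that _ MK.subgroup_axioms]) (simp add: \<tau>(1)[OF x])
        show "M #>\<^bsub>?K\<^esub> \<tau> x = M" if "\<tau> x \<in> M"
          by (rule K.coset_join2[OF _ MK.subgroup_axioms that]) (simp add: \<tau>(1)[OF x])
      qed
      moreover obtain j where j: "\<alpha> x = \<tau> x \<otimes> v [^] (j::nat)"
        using \<tau>(2) x by blast
      \<comment> \<open>Elements of \<open>M\<close> are powers of \<open>v\<close>, so
        \<open>\<alpha> x\<close> also has a factorisation with \<open>H\<close>-part
        \<open>\<one>\<close>, and \<open>H\<close>-parts agree modulo \<open>M\<close>.\<close>
      moreover have "\<tau> x \<in> M" if ax: "\<alpha> x \<in> M"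
      proof -
        obtain l where "\<alpha> x = v [^] (p * l)"
          using M_as_v_pow[OF ax] by blast
        then have "\<tau> x \<otimes> v [^] j = \<one> \<otimes> v [^] (p * l)"
          using j by simp
        then obtain m where "m \<in> M" "\<tau> x = m \<otimes> \<one>"
          using decomp_unique_mod_M[OF \<tau>(1)[OF x] subgroup.one_closed[OF subgroup_axioms]] by blast
        then show ?thesis
          using M_closed by simp
      qed
      \<comment> \<open>Here \<open>\<alpha> x\<close> is a power of \<open>v\<close>, hence
        central, and so is \<open>x\<close>. Thus \<open>x\<close> lies in Z(H) = \<open>D\<close>,
        and \<open>\<alpha> x\<close> is a power of \<open>w\<close> lying in
        \<open>H\<close>.\<close>
      moreover have "\<alpha> x \<in> M" if tx: "\<tau> x \<in> M"
      proof -
        obtain l where "\<tau> x = v [^] (p * l)"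
          using M_as_v_pow[OF tx] by blast
        then have ax: "\<alpha> x = v [^] (p * l + j)"
          using j by (simp add: nat_pow_mult)
        then have "x \<in> group_center G"
          using auto_preimage_center[of x] x v_center[of "p * l + j"] by simp
        then have "x \<in> {z \<in> H. \<forall>y\<in>H. z \<otimes> y = y \<otimes> z}"
          using x by (simp add: group_center_def)
        then have "x \<in> D"
          by (simp only: center_H)
        then have "\<alpha> x \<in> H"
          using auto_D D_in_H by blast
        then show ?thesis
          using ax w_pow_in_H[of "p * (p * l + j)"] by (simp add: nat_pow_pow)
      qed
      ultimately show ?thesis
        using auto_M_iff[of x] mem_carrier[OF x] by argo
    qed
    then show ?thesis
      using M_H by (auto simp: kernel_def \<psi>_def)
  qed
  ultimately have "\<exists>d\<in>derived ?K (carrier ?K). \<psi> x = M #>\<^bsub>?K\<^esub> (x \<otimes>\<^bsub>?K\<^esub> d)"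
    using MK.hom_to_quotient_central[OF _ quotient_auto_comm quotient_center, of \<psi> x] finite_H x
    by simp
  then obtain d where d: "d \<in> derived ?K H" "\<psi> x = M #>\<^bsub>?K\<^esub> (x \<otimes> d)"
    by (elim bexE) simp
  have dD: "d \<in> D"
    using d(1) derived_consistent[OF _ subgroup_axioms, of H] by simp
  \<comment> \<open>Back from cosets to elements: \<open>\<tau> x\<close> equals
    \<open>x \<otimes> d\<close> up to a factor \<open>m\<close> from \<open>M\<close>, which is
    finally absorbed into \<open>D\<close>.\<close>
  have "\<tau> x \<in> M #>\<^bsub>?K\<^esub> (x \<otimes> d)"
    using d(2) K.rcos_self[OF _ MK.subgroup_axioms, of "\<tau> x"] \<tau>(1) x by (simp add: \<psi>_def)
  then obtain m where m: "m \<in> M" "\<tau> x = m \<otimes> (x \<otimes> d)"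
    by (auto simp: r_coset_def)
  have "\<tau> x = m \<otimes> d \<otimes> x"
    using m dD x M_closed D_commute_H[OF dD x] by (simp add: m_assoc)
  moreover obtain j where "\<alpha> x = \<tau> x \<otimes> v [^] (j::nat)"
    using \<tau>(2) x by blast
  moreover have "x \<otimes> v [^] j = v [^] j \<otimes> x"
    using x center_commute[OF v_center] by simp
  ultimately have "\<alpha> x = m \<otimes> d \<otimes> v [^] j \<otimes> x"
    using m(1) dD x M_closed by (simp add: m_assoc)
  then show ?thesis
    using m(1) dD M_D by (meson D_mult)
qed

lemma auto_H_center_mult:
  assumes x: "x \<in> H" obtains z where "z \<in> group_center G" "\<alpha> x = z \<otimes> x"
proof -
  obtain d j where d: "d \<in> D" "\<alpha> x = d \<otimes> v [^] (j::nat) \<otimes> x"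
    using auto_H_central[OF x] by blast
  have "d \<otimes> v [^] j \<in> group_center G"
  proof (rule centerI)
    show "d \<otimes> v [^] j \<otimes> w = w \<otimes> (d \<otimes> v [^] j)"
      using d(1) center_commute[OF v_center, of w j] center_lcomm[OF D_in_center[OF d(1)], of w "v [^] j"]
      by (simp add: m_assoc)
    show "d \<otimes> v [^] j \<otimes> y = y \<otimes> (d \<otimes> v [^] j)" if "y \<in> H" for y
      using d(1) that center_commute[OF v_center, of y j] center_lcomm[OF D_in_center[OF d(1)], of y "v [^] j"]
      by (simp add: m_assoc)
  qed (use d(1) in simp)
  then show ?thesis
    using that d(2) by blast
qed

text \<open>\<open>\<alpha>\<close> multiplies \<open>x\<close> and \<open>y\<close> by central
  elements \<open>s\<close> and \<open>t\<close>, which do not affect commutators. The equation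
  \<open>x \<otimes> y = c \<otimes> (y \<otimes> x)\<close> is used in place of one with
  inverses.\<close>

lemma auto_D_id:
  assumes "d \<in> D" shows "\<alpha> d = d"
proof -
  have "subgroup {c \<in> carrier G. \<alpha> c = c} G"
    by (rule subgroupI) (auto intro!: exI[of _ \<one>])
  moreover have "x \<otimes> y \<otimes> inv x \<otimes> inv y \<in> {c \<in> carrier G. \<alpha> c = c}" if xy: "x \<in> H" "y \<in> H" for x y
  proof -
    define c where "c = x \<otimes> y \<otimes> inv x \<otimes> inv y"
    have c: "c \<in> carrier G" and eq: "x \<otimes> y = c \<otimes> (y \<otimes> x)"
      using commutator_twist[of y x] xy by (simp_all add: c_def)
    obtain s where s: "s \<in> group_center G" "\<alpha> x = s \<otimes> x"
      using auto_H_center_mult xy(1) by blast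
    obtain t where t: "t \<in> group_center G" "\<alpha> y = t \<otimes> y"
      using auto_H_center_mult xy(2) by blast
    have cl: "x \<in> carrier G" "y \<in> carrier G" "s \<in> carrier G" "t \<in> carrier G"
      using xy s t center_closed by auto
    have "\<alpha> c \<otimes> (\<alpha> y \<otimes> \<alpha> x) = \<alpha> x \<otimes> \<alpha> y"
      using c cl by (simp flip: \<alpha>.hom_mult eq)
    also have "\<alpha> x \<otimes> \<alpha> y = s \<otimes> (x \<otimes> (t \<otimes> y))"
      using cl by (simp add: s t m_assoc)
    also have "x \<otimes> (t \<otimes> y) = t \<otimes> (x \<otimes> y)"
      by (rule center_lcomm[OF t(1) cl(1,2)])
    also have "s \<otimes> (t \<otimes> (x \<otimes> y)) = t \<otimes> (s \<otimes> (c \<otimes> (y \<otimes> x)))"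
      unfolding eq[symmetric] by (rule center_lcomm[OF t(1)]) (use cl in simp_all)
    also have "s \<otimes> (c \<otimes> (y \<otimes> x)) = c \<otimes> (s \<otimes> (y \<otimes> x))"
      by (rule center_lcomm[OF s(1), symmetric]) (use c cl in simp_all)
    also have "s \<otimes> (y \<otimes> x) = y \<otimes> (s \<otimes> x)"
      by (rule center_lcomm[OF s(1), symmetric]) (use c cl in simp_all)
    also have "t \<otimes> (c \<otimes> (y \<otimes> (s \<otimes> x))) = c \<otimes> (t \<otimes> (y \<otimes> (s \<otimes> x)))"
      by (rule center_lcomm[OF t(1), symmetric]) (use c cl in simp_all)
    also have "t \<otimes> (y \<otimes> (s \<otimes> x)) = \<alpha> y \<otimes> \<alpha> x"
      using cl by (simp add: s t m_assoc)
    finally have "\<alpha> c = c"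
      by (subst (asm) right_cancel) (use c cl in simp_all)
    with c show ?thesis
      by (simp add: c_def)
  qed
  ultimately have "D \<subseteq> {c \<in> carrier G. \<alpha> c = c}"
    by (rule D_leI)
  then show ?thesis
    using assms by blast
qed

text \<open>The relation \<open>v [^] (j * p) = \<one>\<close> arises because \<open>x [^] p\<close>
  lies in \<open>D\<close> and is therefore fixed by \<open>\<alpha>\<close>. It later ensures that
  every automorphism fixes \<open>v [^] j\<close>.\<close>

lemma auto_on_H:
  assumes x: "x \<in> H"
  shows "\<exists>d\<in>D. \<exists>j::nat. \<alpha> x = d \<otimes> v [^] j \<otimes> x \<and> v [^] (j * p) = \<one>"
proof -
  obtain d j where d: "d \<in> D" "\<alpha> x = d \<otimes> v [^] (j::nat) \<otimes> x"
    using auto_H_central[OF x] by blast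
  have "\<alpha> x = (d \<otimes> x) \<otimes> w [^] (p * j)"
    using d x center_commute[OF v_center, of x j] by (simp add: m_assoc nat_pow_pow)
  then have "\<alpha> x [^] p = (d \<otimes> x) [^] p \<otimes> v [^] (j * p)"
    using mult_pow_p[of "d \<otimes> x" "p * j"] d x D_in_H by (simp add: nat_pow_pow mult.assoc)
  also have "(d \<otimes> x) [^] p = x [^] p"
    using pow_mult_distrib[of d x p] D_commute_H[OF d(1) x] D_exponent d(1) x by simp
  also have "\<alpha> x [^] p = x [^] p"
    using auto_D_id[OF pow_in_derived[OF x]] x by (simp add: \<alpha>.hom_nat_pow)
  finally have "x [^] p \<otimes> \<one> = x [^] p \<otimes> v [^] (j * p)"
    using x by simp
  then have "v [^] (j * p) = \<one>"
    by (subst (asm) Units_l_cancel) (use x in simp_all)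
  with d show ?thesis
    by blast
qed

text \<open>As \<open>\<alpha>\<close> fixes \<open>d = [w, x]\<close> and is central on
  \<open>H\<close>, the element \<open>g\<close> satisfies \<open>[g, x] = d^(1 - i)\<close>. Were
  \<open>i\<close> not 1 modulo \<open>p\<close>, a power of \<open>g\<close> would act on
  \<open>H\<close> as \<open>w\<close> does. So \<open>g\<close> centralises \<open>H\<close>, lies
  in \<open>D\<close>, and \<open>w [^] i\<close> is \<open>w\<close> times a power of
  \<open>v\<close>.\<close>

lemma auto_on_w: "\<exists>a\<in>D. \<exists>l::nat. \<alpha> w = a \<otimes> v [^] l \<otimes> w"
proof -
  obtain g i where g: "g \<in> H" and aw: "\<alpha> w = g \<otimes> w [^] (i::nat)"
    using carrier_decomp \<alpha>.hom_closed w_closed by blast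
  \<comment> \<open>\<open>?n\<close> stands for \<open>1 - i\<close> modulo \<open>p\<close>.\<close>
  let ?n = "1 + (p - 1) * i"
  have key: "\<exists>d\<in>D. w \<otimes> x = d \<otimes> (x \<otimes> w) \<and> g \<otimes> x = d [^] ?n \<otimes> (x \<otimes> g)" if x: "x \<in> H" for x
  proof -
    obtain d where d: "d \<in> D" and tw: "\<And>i::nat. w [^] i \<otimes> x = d [^] i \<otimes> (x \<otimes> w [^] i)"
      using w_pow_twist[OF x] by blast
    obtain z where z: "z \<in> group_center G" "\<alpha> x = z \<otimes> x"
      using auto_H_center_mult x by blast
    have cl: "x \<in> carrier G" "g \<in> carrier G" "z \<in> carrier G" "d \<in> carrier G"
      using x g z d center_closed by auto
    have wx: "w \<otimes> x = d \<otimes> (x \<otimes> w)"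
      using tw[of 1] cl by simp
    have "\<alpha> w \<otimes> \<alpha> x = \<alpha> d \<otimes> (\<alpha> x \<otimes> \<alpha> w)"
      using cl wx by (simp flip: \<alpha>.hom_mult)
    also have "\<dots> = d \<otimes> (z \<otimes> (x \<otimes> \<alpha> w))"
      using cl z(2) d by (simp add: auto_D_id m_assoc)
    also have "\<dots> = z \<otimes> (d \<otimes> (x \<otimes> \<alpha> w))"
      by (rule center_lcomm[OF z(1)]) (use cl in simp_all)
    also have "\<alpha> w \<otimes> \<alpha> x = z \<otimes> (\<alpha> w \<otimes> x)"
      unfolding z(2) by (rule center_lcomm[OF z(1)]) (use cl in simp_all)
    finally have "\<alpha> w \<otimes> x = d \<otimes> (x \<otimes> \<alpha> w)"
      by (subst (asm) Units_l_cancel) (use cl in simp_all)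
    then have "g \<otimes> (d [^] i \<otimes> (x \<otimes> w [^] i)) = d \<otimes> (x \<otimes> (g \<otimes> w [^] i))"
      using cl by (simp add: aw m_assoc tw)
    moreover have "g \<otimes> (d [^] i \<otimes> (x \<otimes> w [^] i)) = d [^] i \<otimes> (g \<otimes> (x \<otimes> w [^] i))"
      by (rule center_lcomm[OF D_in_center]) (use d cl in simp_all)
    ultimately have "(d [^] i \<otimes> (g \<otimes> x)) \<otimes> w [^] i = (d \<otimes> (x \<otimes> g)) \<otimes> w [^] i"
      using cl by (simp add: m_assoc)
    then have *: "d [^] i \<otimes> (g \<otimes> x) = d \<otimes> (x \<otimes> g)"
      by (subst (asm) right_cancel) (use cl in simp_all)
    have pi: "(p - 1) * i + i = p * i" "(p - 1) * i + 1 = ?n"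
      using p_pos by (cases p; simp)+
    \<comment> \<open>Multiplication by \<open>d [^] ((p - 1) * i)\<close>, the inverse of
      \<open>d [^] i\<close>, isolates \<open>g \<otimes> x\<close>.\<close>
    have "g \<otimes> x = d [^] (p * i) \<otimes> (g \<otimes> x)"
      using cl D_exponent[OF d] by (simp flip: nat_pow_pow)
    also have "\<dots> = d [^] ((p - 1) * i) \<otimes> (d [^] i \<otimes> (g \<otimes> x))"
      unfolding pi(1)[symmetric] using cl by (simp add: m_assoc flip: nat_pow_mult)
    also have "\<dots> = (d [^] ((p - 1) * i) \<otimes> d [^] (1::nat)) \<otimes> (x \<otimes> g)"
      unfolding * using cl by (simp add: m_assoc)
    also have "\<dots> = d [^] ?n \<otimes> (x \<otimes> g)"
      unfolding nat_pow_mult[OF cl(4)] pi(2) ..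
    finally show ?thesis
      using d wx by blast
  qed
  \<comment> \<open>Otherwise \<open>w\<close> acts on \<open>H\<close> like a power of \<open>g\<close>.\<close>
  have "p dvd ?n"
  proof (rule ccontr)
    assume "\<not> p dvd ?n"
    then have "coprime ?n p"
      using prime_p prime_imp_coprime by (metis coprime_commute)
    \<comment> \<open>\<open>j\<close> inverts \<open>?n\<close> modulo \<open>p\<close>, so
      \<open>[g^j, x] = [w, x]\<close>. Since \<open>j\<close> does not depend on \<open>x\<close>,
      this holds for all \<open>x\<close> in \<open>H\<close> at once.\<close>
    moreover obtain j y where "?n * j = p * y + gcd ?n p"
      using bezout_nat[of ?n p] by auto
    ultimately have nj: "?n * j = p * y + 1"
      by simp
    have "w \<otimes> x \<otimes> inv w = g [^] j \<otimes> x \<otimes> inv (g [^] j)" if x: "x \<in> H" for x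
    proof -
      obtain d where d: "d \<in> D" "w \<otimes> x = d \<otimes> (x \<otimes> w)" "g \<otimes> x = d [^] ?n \<otimes> (x \<otimes> g)"
        using key[OF x] by blast
      have cl: "x \<in> carrier G" "g \<in> carrier G" "d \<in> carrier G"
        using x g d by auto
      have dn: "d [^] ?n \<in> D"
        using d(1) by (rule D_pow)
      have "g [^] j \<otimes> x = (d [^] ?n) [^] j \<otimes> (x \<otimes> g [^] j)"
        by (rule pow_mult_twisted_commute[OF cl(1,2) _ d(3) D_commute_H[OF dn g]]) (use cl in simp)
      also have "(d [^] ?n) [^] j = (d [^] p) [^] y \<otimes> d"
        unfolding nat_pow_pow[OF cl(3)] nj using cl by simp
      also have "\<dots> = d"
        using cl D_exponent[OF d(1)] by simp
      finally show ?thesis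
        using cl d(2) by (simp add: m_assoc)
    qed
    then show False
      using w_not_inner[OF H_pow[OF g, of j]] by blast
  qed
  have "g \<otimes> x = x \<otimes> g" if x: "x \<in> H" for x
  proof -
    obtain d where d: "d \<in> D" "g \<otimes> x = d [^] ?n \<otimes> (x \<otimes> g)"
      using key[OF x] by blast
    obtain k where "?n = p * k"
      using \<open>p dvd ?n\<close> ..
    then have "d [^] ?n = \<one>"
      using d(1) D_exponent[OF d(1)] by (simp flip: nat_pow_pow)
    then show ?thesis
      unfolding d(2) using g x by simp
  qed
  then have "g \<in> {z \<in> H. \<forall>x\<in>H. z \<otimes> x = x \<otimes> z}"
    using g by simp
  then have gD: "g \<in> D"
    by (simp only: center_H)
  \<comment> \<open>\<open>i = 0\<close> is excluded because it would give \<open>?n = 1\<close>.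
    With \<open>i' = i - 1\<close>, divisibility of \<open>?n\<close> by \<open>p\<close> turns into
    that of \<open>i'\<close>.\<close>
  obtain i' where i: "i = Suc i'"
    using \<open>p dvd ?n\<close> prime_p by (cases i) auto
  have "?n + i' = p * i"
    using p_pos i by (cases p) simp_all
  then have "p dvd i'"
    using \<open>p dvd ?n\<close> by (metis dvd_add_right_iff dvd_triv_left)
  then obtain l where "i' = p * l" ..
  then have "w [^] i = v [^] l \<otimes> w"
    by (simp add: i nat_pow_pow)
  then have "\<alpha> w = g \<otimes> v [^] l \<otimes> w"
    using aw g by (simp add: m_assoc)
  then show ?thesis
    using gD by blast
qed

text \<open>The factor \<open>a\<close> dies under the \<open>p\<close>-th power, so
  \<open>\<alpha>\<close> raises \<open>v\<close> to the power \<open>p * l + 1\<close>.\<close>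

lemma auto_on_v:
  assumes a: "a \<in> D" and aw: "\<alpha> w = a \<otimes> v [^] (l::nat) \<otimes> w"
  shows "\<alpha> (v [^] (k::nat)) = v [^] (p * l * k + k)"
proof -
  have "\<alpha> w = a \<otimes> w [^] (p * l + 1)"
    using a by (simp add: aw m_assoc nat_pow_pow)
  then have "\<alpha> v = (a \<otimes> w [^] (p * l + 1)) [^] p"
    by (simp add: \<alpha>.hom_nat_pow)
  also have "\<dots> = w [^] ((p * l + 1) * p)"
    unfolding mult_pow_p[OF D_in_H[OF a]] D_exponent[OF a] by (rule l_one) simp
  also have "\<dots> = v [^] (p * l + 1)"
    unfolding nat_pow_pow[OF w_closed] by (simp only: mult.commute)
  finally have "\<alpha> (v [^] k) = (v [^] (p * l + 1)) [^] k"
    by (simp only: \<alpha>.hom_nat_pow nat_pow_closed w_closed)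
  also have "\<dots> = v [^] ((p * l + 1) * k)"
    by (rule nat_pow_pow) simp
  finally show ?thesis
    by (simp only: distrib_right mult_1)
qed

end

section \<open>Composition of two automorphisms\<close>

lemma twist_mult:
  assumes "a \<in> D" "b \<in> D" "x \<in> carrier G"
  shows "a \<otimes> v [^] (m::nat) \<otimes> (b \<otimes> v [^] (k::nat) \<otimes> x) = a \<otimes> b \<otimes> v [^] (m + k) \<otimes> x"
proof -
  have "a \<otimes> v [^] m \<otimes> (b \<otimes> v [^] k \<otimes> x) = a \<otimes> (v [^] m \<otimes> (b \<otimes> (v [^] k \<otimes> x)))"
    using assms by (simp add: m_assoc)
  also have "v [^] m \<otimes> (b \<otimes> (v [^] k \<otimes> x)) = b \<otimes> (v [^] m \<otimes> (v [^] k \<otimes> x))"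
    by (rule center_lcomm[OF D_in_center]) (use assms in simp_all)
  finally show ?thesis
    using assms by (simp add: m_assoc flip: nat_pow_mult)
qed

lemma D_commute: "a \<in> D \<Longrightarrow> b \<in> D \<Longrightarrow> a \<otimes> b = b \<otimes> a"
  using D_commute_H D_in_H by blast

text \<open>On \<open>w\<close>, both composites carry the factor \<open>a \<otimes> b\<close> and
  the exponent \<open>p * l * m + l + m\<close> of \<open>v\<close>, symmetric in the two
  automorphisms. On \<open>H\<close>, the powers of \<open>v\<close> that occur are fixed by both,
  so the central factors simply multiply.\<close>

lemma auto_comp_commute:
  assumes al: "\<alpha> \<in> auto G" and be: "\<beta> \<in> auto G" and g: "g \<in> carrier G"
  shows "\<alpha> (\<beta> g) = \<beta> (\<alpha> g)"
proof -
  interpret \<alpha>: group_hom G G \<alpha>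
    using autoD(1)[OF al] by (simp add: group_hom_def group_hom_axioms_def is_group)
  interpret \<beta>: group_hom G G \<beta>
    using autoD(1)[OF be] by (simp add: group_hom_def group_hom_axioms_def is_group)
  obtain a l where a: "a \<in> D" and aw: "\<alpha> w = a \<otimes> v [^] (l::nat) \<otimes> w"
    using auto_on_w[OF al] by blast
  obtain b m where b: "b \<in> D" and bw: "\<beta> w = b \<otimes> v [^] (m::nat) \<otimes> w"
    using auto_on_w[OF be] by blast
  note av = auto_on_v[OF al a aw] and bv = auto_on_v[OF be b bw]
  have w: "\<alpha> (\<beta> w) = \<beta> (\<alpha> w)"
  proof -
    have "\<alpha> (\<beta> w) = b \<otimes> v [^] (p * l * m + m) \<otimes> (a \<otimes> v [^] l \<otimes> w)"
      unfolding bw using b auto_D_id[OF al b] by (simp add: av flip: aw)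
    also have "\<dots> = b \<otimes> a \<otimes> v [^] (p * l * m + m + l) \<otimes> w"
      using a b by (simp add: twist_mult)
    also have "\<dots> = a \<otimes> b \<otimes> v [^] (p * m * l + l + m) \<otimes> w"
      by (simp add: D_commute[OF b a] algebra_simps)
    also have "\<dots> = a \<otimes> v [^] (p * m * l + l) \<otimes> (b \<otimes> v [^] m \<otimes> w)"
      using a b by (simp add: twist_mult)
    also have "\<dots> = \<beta> (\<alpha> w)"
      unfolding aw using a auto_D_id[OF be a] by (simp add: bv flip: bw)
    finally show ?thesis .
  qed
  have H: "\<alpha> (\<beta> x) = \<beta> (\<alpha> x)" if x: "x \<in> H" for x
  proof -
    obtain c i where c: "c \<in> D" and ax: "\<alpha> x = c \<otimes> v [^] (i::nat) \<otimes> x" and vi: "v [^] (i * p) = \<one>"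
      using auto_on_H[OF al x] by blast
    obtain d j where d: "d \<in> D" and bx: "\<beta> x = d \<otimes> v [^] (j::nat) \<otimes> x" and vj: "v [^] (j * p) = \<one>"
      using auto_on_H[OF be x] by blast
    have "v [^] (p * l * j + j) = (v [^] (j * p)) [^] l \<otimes> v [^] j"
      "v [^] (p * m * i + i) = (v [^] (i * p)) [^] m \<otimes> v [^] i"
      by (simp_all add: nat_pow_pow nat_pow_mult algebra_simps)
    then have avj: "\<alpha> (v [^] j) = v [^] j" and bvi: "\<beta> (v [^] i) = v [^] i"
      by (simp_all add: av bv vi vj)
    have "\<alpha> (\<beta> x) = d \<otimes> v [^] j \<otimes> (c \<otimes> v [^] i \<otimes> x)"
      unfolding bx using d x auto_D_id[OF al d] by (simp add: avj flip: ax)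
    also have "\<dots> = c \<otimes> v [^] i \<otimes> (d \<otimes> v [^] j \<otimes> x)"
      using c d x by (simp add: twist_mult D_commute[OF d c] add.commute)
    also have "\<dots> = \<beta> (\<alpha> x)"
      unfolding ax using c x auto_D_id[OF be c] by (simp add: bvi flip: bx)
    finally show ?thesis .
  qed
  obtain x i where "x \<in> H" "g = x \<otimes> w [^] (i::nat)"
    using carrier_decomp g by blast
  then show ?thesis
    using H w by (simp add: \<alpha>.hom_nat_pow \<beta>.hom_nat_pow)
qed

text \<open>If the central element \<open>v\<close> were in G', it would lie in \<open>H\<close>,
  hence in \<open>M\<close>, and \<open>w [^] (p * p) = \<one>\<close> would contradict the order of
  \<open>w\<close>.\<close>

lemma not_special: "\<not> special_group G"
proof
  assume "special_group G"
  then have "v \<in> derived G (carrier G)"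
    using w_pow_p_in_center by (simp add: special_group_def)
  then have "v \<in> M"
    using derived_carrier_subset w_pow_in_H by blast
  then have "w [^] (p * p) = \<one>"
    using D_exponent[OF M_D, of v] by (simp add: nat_pow_pow)
  then have "p ^ 3 dvd p * p"
    using ord_w(1) by (simp add: pow_eq_id) (meson dvd_trans)
  then have "p dvd 1"
    using p_pos by (simp add: power3_eq_cube)
  then show False
    using prime_p by (simp add: prime_nat_iff)
qed

end

section \<open>The Miller group\<close>

theorem theoremD:
  fixes G :: "('a, 'b) monoid_scheme" and H M :: "'a set" and w :: 'a and p :: nat
  assumes "prime p" and "odd p"
    and "group G" and "subgroup H G"
    and "finite H"
    and "p_group p (G\<lparr>carrier := H\<rparr>)"
    and "special_group (G\<lparr>carrier := H\<rparr>)"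
    and "miller_group (G\<lparr>carrier := H\<rparr>)"
    and "power_subgroup (G\<lparr>carrier := H\<rparr>) p \<subset> derived (G\<lparr>carrier := H\<rparr>) H"
    and "inj_on (coset_power (G\<lparr>carrier := H\<rparr>) p)
           (carrier ((G\<lparr>carrier := H\<rparr>) Mod derived (G\<lparr>carrier := H\<rparr>) H))"
    and "commutators_freely_generate p (G\<lparr>carrier := H\<rparr>)"
    and "subgroup M (G\<lparr>carrier := H\<rparr>)" and "card M = p"
    and "M \<subseteq> derived (G\<lparr>carrier := H\<rparr>) H"
    and "\<not> M \<subseteq> power_subgroup (G\<lparr>carrier := H\<rparr>) p"
    and "w \<in> carrier G"
    and "amalgamated_semidirect_product G H (generate G {w}) M"
    and "p_group p (G\<lparr>carrier := generate G {w}\<rparr>)"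
    and "group.ord G w > p ^ 2"
    and "central_automorphism (G\<lparr>carrier := H\<rparr>) (conjugation G w H)"
    and "\<not> inner_automorphism (G\<lparr>carrier := H\<rparr>) (conjugation G w H)"
    and "p_group p ((G\<lparr>carrier := H\<rparr>) Mod M)"
    and "special_group ((G\<lparr>carrier := H\<rparr>) Mod M)"
    and "miller_group ((G\<lparr>carrier := H\<rparr>) Mod M)"
  shows "miller_group G \<and> \<not> special_group G"
proof -

  \<comment> \<open>Passage from the subgroup records to statements inside \<open>G\<close>\<close>
  interpret group G by fact
  interpret subgroup H G by fact
  let ?K = "G\<lparr>carrier := H\<rparr>"
  interpret K: group ?K
    by (rule subgroup_imp_group) fact
  note p = \<open>prime p\<close>
  have Kpow: "x [^]\<^bsub>?K\<^esub> n = x [^]\<^bsub>G\<^esub> n" for x and n :: nat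
    by (rule nat_pow_consistent[symmetric])
  have Kinv: "inv\<^bsub>?K\<^esub> x = inv\<^bsub>G\<^esub> x" if "x \<in> H" for x
    using m_inv_consistent[OF assms(4) that] .
  have DK: "derived ?K H = derived G H"
    using derived_consistent[OF _ assms(4), of H] by simp
  have amalgam: "H \<lhd> G" "carrier G = H <#>\<^bsub>G\<^esub> generate G {w}" "H \<inter> generate G {w} = M"
    using assms(17) by (simp_all add: amalgamated_semidirect_product_def)
  have center: "group_center ?K = derived G H"
    using assms(7) DK by (simp add: special_group_def)
  have ord0: "ord w \<noteq> 0"
    using assms(19) by auto
  have gen_w: "generate G {w} = {w [^]\<^bsub>G\<^esub> k |k. k \<in> (UNIV :: nat set)}"
    using generate_pow_nat[OF assms(16) ord0] .
  \<comment> \<open>The \<open>p\<close>-group hypothesis speaks of the order of \<open>w\<close> in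
    the record for \<open>generate G {w}\<close>. An order is determined by the exponents that kill
    \<open>w\<close>, and these are the same in \<open>G\<close>.\<close>
  obtain n where n: "ord w = p ^ n"
  proof -
    let ?W = "G\<lparr>carrier := generate G {w}\<rparr>"
    have W: "group ?W"
      using assms(18) by (simp add: p_group_def)
    have wW: "w \<in> carrier ?W"
      by (simp add: generate.incl)
    then obtain k where "group.ord ?W w = p ^ k"
      using assms(18) unfolding p_group_def by blast
    then have "\<forall>n. w [^]\<^bsub>G\<^esub> n = \<one>\<^bsub>G\<^esub> \<longleftrightarrow> p ^ k dvd n"
      using group.ord_unique[OF W wW] nat_pow_consistent[of w _ "generate G {w}"] by simp
    then show ?thesis
      using that ord_unique[OF assms(16)] by blast
  qed
  have "p ^ 2 < p ^ n"
    using assms(19) n by simp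
  then have n2: "2 < n"
    using prime_gt_1_nat[OF p] power_less_imp_less_exp by blast
  interpret class_two_extension H G p w
  proof (intro class_two_extension.intro class_two_extension_axioms.intro)
    show "H \<lhd> G" "prime p" "odd p" "w \<in> carrier G"
      by fact+
    show "{z \<in> H. \<forall>x\<in>H. z \<otimes>\<^bsub>G\<^esub> x = x \<otimes>\<^bsub>G\<^esub> z} = derived G H"
      using center by (simp add: group_center_def)
    show "x [^]\<^bsub>G\<^esub> p \<in> derived G H" if "x \<in> H" for x
    proof -
      have "x [^]\<^bsub>G\<^esub> p \<in> power_subgroup ?K p"
        unfolding power_subgroup_def Kpow using that by (intro generate.incl) simp
      then show ?thesis
        using assms(9) DK by auto
    qed
    show "w \<otimes>\<^bsub>G\<^esub> x \<otimes>\<^bsub>G\<^esub> inv\<^bsub>G\<^esub> w \<otimes>\<^bsub>G\<^esub> inv\<^bsub>G\<^esub> x \<in> derived G H" if x: "x \<in> H" for x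
    proof -
      let ?f = "conjugation G w H"
      have f: "?f \<in> auto ?K" "group_center ?K #>\<^bsub>?K\<^esub> ?f x = group_center ?K #>\<^bsub>?K\<^esub> x"
        using assms(20) x by (simp_all add: central_automorphism_def)
      have "?f x \<in> H"
        using autoD(1)[OF f(1)] x by (auto simp: hom_def)
      moreover have "subgroup (group_center ?K) ?K"
        using assms(7) K.derived_is_subgroup[of H] by (simp add: special_group_def)
      ultimately have "?f x \<in> group_center ?K #>\<^bsub>?K\<^esub> x"
        using K.rcos_self[of "?f x" "group_center ?K"] f(2) by simp
      then obtain z where z: "z \<in> derived G H" "w \<otimes>\<^bsub>G\<^esub> x \<otimes>\<^bsub>G\<^esub> inv\<^bsub>G\<^esub> w = z \<otimes>\<^bsub>G\<^esub> x"
        using x by (auto simp: r_coset_def center conjugation_def)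
      have "z \<in> carrier G"
        using z(1) derived_in_carrier[OF subset] by blast
      then show ?thesis
        unfolding z(2) using z(1) x by (simp add: m_assoc)
    qed
    show "\<exists>x\<in>H. \<exists>i::nat. g = x \<otimes>\<^bsub>G\<^esub> w [^]\<^bsub>G\<^esub> i" if "g \<in> carrier G" for g
      using that unfolding amalgam(2) set_mult_def gen_w by blast
  qed
  have M_sub: "subgroup M G"
    using incl_subgroup[OF assms(4,12)] .
  have M_D: "M \<subseteq> derived G H"
    using assms(14) DK by simp
  have finM: "finite M"
    using assms(13) prime_gt_0_nat[OF p] by (simp add: card_ge_0_finite)
  \<comment> \<open>A nontrivial \<open>p\<close>-th power in \<open>M\<close> has order
    \<open>p\<close> and generates \<open>M\<close>. Its powers are again \<open>p\<close>-th
    powers, so \<open>M\<close> would be contained in H^p.\<close>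
  have M_powers: "x [^]\<^bsub>G\<^esub> p = \<one>\<^bsub>G\<^esub>" if x: "x \<in> H" "x [^]\<^bsub>G\<^esub> p \<in> M" for x
  proof (rule ccontr)
    let ?y = "x [^]\<^bsub>G\<^esub> p"
    assume ne: "?y \<noteq> \<one>\<^bsub>G\<^esub>"
    have y: "?y \<in> carrier G"
      using x by simp
    have "?y [^]\<^bsub>G\<^esub> p = \<one>\<^bsub>G\<^esub>"
      using D_exponent M_D x(2) by blast
    then have "ord ?y dvd p"
      using y by (simp add: pow_eq_id)
    moreover have "ord ?y \<noteq> 1"
      using ord_eq_1[OF y] ne by simp
    ultimately have ordy: "ord ?y = p"
      using p by (metis prime_nat_iff)
    have "generate G {?y} \<subseteq> M"
      using generate_subgroup_incl[OF _ M_sub] x(2) by simp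
    moreover have "card (generate G {?y}) = card M"
      using generate_pow_card[OF y] ordy assms(13) by simp
    ultimately have "M = generate G {?y}"
      using finM card_subset_eq by blast
    also have "generate G {?y} = {?y [^]\<^bsub>G\<^esub> k |k. k \<in> (UNIV :: nat set)}"
      using generate_pow_nat[OF y] ordy prime_gt_0_nat[OF p] by simp
    finally have "M = {?y [^]\<^bsub>G\<^esub> k |k. k \<in> (UNIV :: nat set)}" .
    moreover have "?y [^]\<^bsub>G\<^esub> k \<in> power_subgroup ?K p" for k :: nat
    proof -
      have "?y [^]\<^bsub>G\<^esub> k = (x [^]\<^bsub>G\<^esub> k) [^]\<^bsub>G\<^esub> p"
        using x by (simp add: nat_pow_pow mult.commute)
      then show ?thesis
        unfolding power_subgroup_def Kpow using H_pow[OF x(1)] by (intro generate.incl) simp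
    qed
    ultimately have "M \<subseteq> power_subgroup ?K p"
      by (auto simp only: mem_Collect_eq)
    with assms(15) show False
      by blast
  qed
  obtain r where r: "n = Suc r"
    using n2 by (cases n) simp_all
  \<comment> \<open>\<open>u\<close> generates the subgroup of order \<open>p\<close> in the cyclic
    group of powers of \<open>w\<close>. It contains \<open>M\<close>, as \<open>D\<close> has
    exponent \<open>p\<close>, and equals \<open>M\<close> by cardinality; this yields
    \<open>omega_subset_M\<close>.\<close>
  define u where "u = w [^]\<^bsub>G\<^esub> (p ^ r)"
  have u: "u \<in> carrier G"
    by (simp add: u_def)
  have ord_u: "ord u = p"
    unfolding u_def using ord_pow[OF assms(16), of "p ^ r"] n r prime_gt_0_nat[OF p] by simp
  have card_u: "card (generate G {u}) = p"
    using generate_pow_card[OF u] ord_u by simp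
  have gen_u: "generate G {u} = {u [^]\<^bsub>G\<^esub> k |k. k \<in> (UNIV :: nat set)}"
    by (rule generate_pow_nat[OF u]) (use ord_u prime_gt_0_nat[OF p] in simp)
  have omega: "w [^]\<^bsub>G\<^esub> i \<in> generate G {u}" if "w [^]\<^bsub>G\<^esub> (i * p) = \<one>\<^bsub>G\<^esub>" for i
  proof -
    have "p ^ r * p dvd i * p"
      using that pow_eq_id[OF assms(16)] n r by (simp add: mult.commute)
    then have "p ^ r dvd i"
      using prime_gt_0_nat[OF p] by simp
    then obtain k where "i = p ^ r * k" ..
    then have "w [^]\<^bsub>G\<^esub> i = u [^]\<^bsub>G\<^esub> k"
      by (simp add: u_def nat_pow_pow)
    then show ?thesis
      unfolding gen_u by blast
  qed
  have M_w: "\<exists>i::nat. m = w [^]\<^bsub>G\<^esub> i" if "m \<in> M" for m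
    using that amalgam(3) gen_w by blast
  have "M \<subseteq> generate G {u}"
  proof
    fix m assume m: "m \<in> M"
    then obtain i where i: "m = w [^]\<^bsub>G\<^esub> (i::nat)"
      using M_w by blast
    have "w [^]\<^bsub>G\<^esub> (i * p) = \<one>\<^bsub>G\<^esub>"
      using D_exponent[of m] m M_D i by (auto simp: nat_pow_pow)
    then show "m \<in> generate G {u}"
      using omega i by blast
  qed
  moreover have "finite (generate G {u})"
    using card_u prime_gt_0_nat[OF p] by (simp add: card_ge_0_finite)
  ultimately have M_u: "M = generate G {u}"
    using card_u assms(13) by (intro card_subset_eq) simp_all
  interpret miller_amalgam H G p w M
  proof (intro miller_amalgam.intro miller_amalgam_axioms.intro)
    show "class_two_extension H G p w"
      by (rule class_two_extension_axioms)
    show "finite H" "subgroup M G" "M \<subseteq> derived G H"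
      by fact+
    show "x \<in> derived G H" if x: "x \<in> H" "x [^]\<^bsub>G\<^esub> p = \<one>\<^bsub>G\<^esub>" for x
    proof -
      have DKsub: "subgroup (derived G H) ?K"
        using K.derived_is_subgroup[of H] by (simp add: DK)
      \<comment> \<open>Applied to \<open>x\<close> and to \<open>\<one>\<close>: their cosets have
        the same image under \<open>coset_power\<close>, and injectivity identifies them.\<close>
      have cp: "coset_power ?K p (derived G H #>\<^bsub>?K\<^esub> y) = \<one>\<^bsub>G\<^esub>" if y: "y \<in> H" "y [^]\<^bsub>G\<^esub> p = \<one>\<^bsub>G\<^esub>" for y
      proof -
        have "(d \<otimes>\<^bsub>G\<^esub> y) [^]\<^bsub>G\<^esub> p = \<one>\<^bsub>G\<^esub>" if d: "d \<in> derived G H" for d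
          using pow_mult_distrib[of d y p] D_commute_H[OF d] y D_exponent[OF d] D_closed[OF d] by simp
        then have "(\<lambda>h. h [^]\<^bsub>G\<^esub> p) ` (derived G H #>\<^bsub>?K\<^esub> y) = {\<one>\<^bsub>G\<^esub>}"
          using subgroup.one_closed[OF D_subgroup] by (auto simp: r_coset_def image_UN)
        then show ?thesis
          unfolding coset_power_def Kpow by simp
      qed
      have "derived G H #>\<^bsub>?K\<^esub> x = derived G H #>\<^bsub>?K\<^esub> \<one>\<^bsub>G\<^esub>"
        by (rule inj_onD[OF assms(10)]) (use x cp in \<open>auto simp: carrier_FactGroup DK\<close>)
      then have "derived G H #>\<^bsub>?K\<^esub> x = derived G H"
        using K.coset_mult_one[of "derived G H"] subgroup.subset[OF DKsub] by simp
      then show ?thesis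
        by (rule K.coset_join1[OF _ _ DKsub]) (simp add: x)
    qed
    show "w [^]\<^bsub>G\<^esub> i \<in> M" if "w [^]\<^bsub>G\<^esub> (i * p) = \<one>\<^bsub>G\<^esub>" for i
      using omega[OF that] M_u by simp
    show "w [^]\<^bsub>G\<^esub> i \<in> M" if "w [^]\<^bsub>G\<^esub> i \<in> H" for i :: nat
      using that amalgam(3) gen_w by blast
    show "\<exists>i::nat. m = w [^]\<^bsub>G\<^esub> i" if "m \<in> M" for m
      by (rule M_w[OF that])
    show "x [^]\<^bsub>G\<^esub> p = \<one>\<^bsub>G\<^esub>" if "x \<in> H" "x [^]\<^bsub>G\<^esub> p \<in> M" for x
      by (rule M_powers[OF that])
    show "p ^ 3 dvd ord w" "ord w \<noteq> 0"
      using n n2 ord0 by (simp_all add: le_imp_power_dvd)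
    show "\<exists>x\<in>H. w \<otimes>\<^bsub>G\<^esub> x \<otimes>\<^bsub>G\<^esub> inv\<^bsub>G\<^esub> w \<noteq> g \<otimes>\<^bsub>G\<^esub> x \<otimes>\<^bsub>G\<^esub> inv\<^bsub>G\<^esub> g" if g: "g \<in> H" for g
    proof (rule ccontr)
      assume "\<not> (\<exists>x\<in>H. w \<otimes>\<^bsub>G\<^esub> x \<otimes>\<^bsub>G\<^esub> inv\<^bsub>G\<^esub> w \<noteq> g \<otimes>\<^bsub>G\<^esub> x \<otimes>\<^bsub>G\<^esub> inv\<^bsub>G\<^esub> g)"
      then have "conjugation G w H = conjugation ?K g (carrier ?K)"
        by (auto simp: conjugation_def Kinv[OF g] intro!: restrict_ext)
      then show False
        using assms(21) g by (auto simp: inner_automorphism_def)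
    qed
    show "comm_group (AutoGroup (?K Mod M))"
      using assms(24) by (simp add: miller_group_def)
    show "group_center (?K Mod M) = derived (?K Mod M) (carrier (?K Mod M))"
      using assms(23) by (simp add: special_group_def)
  qed
  have "\<not> comm_group G"
  proof
    assume "comm_group G"
    then interpret G: comm_group G .
    have "comm_group ?K"
      by (rule K.group_comm_groupI) (simp add: G.m_comm)
    then show False
      using assms(8) by (simp add: miller_group_def)
  qed
  moreover have "comm_group (AutoGroup G)"
    by (rule comm_group_AutoGroupI) (rule auto_comp_commute)
  ultimately show ?thesis
    using not_special assms(3) by (simp add: miller_group_def)
qed

end
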